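(* Let $P(z)$ be the associated Laurent polynomial of the Cayley graph $\mathcal{D}_{n}=Cay(\mathbb{D}_{n}, b^{\pm\beta_1},\ldots,b^{\pm\beta_s}, a b^{\gamma_1},\ldots, a b^{\gamma_t})$. Denote by $Q(w)$ the Chebyshev transform of $P(z)$ and let $r$ be the degree of the polynomial $Q(w)$. Then the number $\tau(n)$ of spanning trees in the graph $\mathcal{D}_n$ is given by the formula $$\tau(n)=\frac{n\,t\, |\eta|^n}{q}\prod_{p=1}^{r-1}|2T(n,w_p)-2|,$$ where $w_p$, $p=1,2,\ldots,r-1$, are the roots, different from $1$, of the algebraic equation $Q(w)=0$, $T(n,w)$ is the Chebyshev polynomial of the first kind, $\eta$ is the leading coefficient of $P(z)$, and $q=2t\sum_{j=1}^{s}\beta_{j}^2+\sum_{1\le j<k\le t}(\gamma_j-\gamma_k)^2$.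
   Context: Let $n\ge 1$ and let $\mathbb{D}_n=\langle a,b\mid a^2=1,\ b^n=1,\ (ab)^2=1\rangle$ be the dihedral group of order $2n$. Let $s\ge 0$, $t\ge 1$ be integers and let $\beta_1,\dots,\beta_s,\gamma_1,\dots,\gamma_t$ be integers with $0<\beta_1<\cdots<\beta_s<\frac n2$ and $0\le\gamma_1<\cdots<\gamma_t\le n-1$. Put $S=\{b^{\pm\beta_1},\ldots,b^{\pm\beta_s},ab^{\gamma_1},\ldots,ab^{\gamma_t}\}$; then $S=S^{-1}$ and $1\notin S$. The Cayley graph $\mathcal{D}_n=Cay(\mathbb{D}_n,b^{\pm\beta_1},\ldots,b^{\pm\beta_s},ab^{\gamma_1},\ldots,ab^{\gamma_t})$ is the simple undirected graph with vertex set $\mathbb{D}_n$ in which $g,h$ are adjacent iff $h=gx$ for some $x\in S$. The associated Laurent polynomial of $\mathcal{D}_n$ is $P(z)=\mathcal{A}(z)\mathcal{A}(z^{-1})-\mathcal{B}(z)\mathcal{B}(z^{-1})$, where $\mathcal{A}(z)=2s+t-\sum_{i=1}^{s}(z^{\beta_i}+z^{-\beta_i})$ and $\mathcal{B}(z)=-\sum_{i=1}^{t}z^{\gamma_i}$. Its leading coefficient $\eta$ is the coefficient of the highest power of $z$ occurring in $P$. Since $P(z)=P(1/z)$, $P$ has the form $P(z)=c_0+\sum_{k=1}^{r}c_k(z^k+z^{-k})$ with $c_r=\eta$. The $n$-th Chebyshev polynomial of the first kind is $T(n,x)=\cos(n\arccos x)$, so $T(n,\frac{z+z^{-1}}2)=\frac{z^n+z^{-n}}2$.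 The Chebyshev transform of $P$ is the polynomial $Q(w)=c_0+\sum_{k=1}^{r}2c_kT(k,w)$, so that $P(z)=Q\left(\frac{z+z^{-1}}{2}\right)$. Roots are listed with multiplicity, and an empty product equals $1$.
   Formalization: The case s = 0, t = 1 is excluded: there P(z) = 0 and q = 0, so the leading coefficient η, the degree r and the right-hand side of the formula are undefined. *)

theory Defs
  imports
    "HOL-Analysis.Analysis"
    "HOL-Algebra.Group"
    "HOL-Computational_Algebra.Computational_Algebra"
    "HOL-Library.Poly_Mapping"
begin

section \<open>Groups given by generators and relators\<close>

text \<open>
  A word over the generators \<open>'x\<close> is a list of letters; the letter \<open>(x, False)\<close> stands for the
  generator \<open>x\<close> and \<open>(x, True)\<close> for its formal inverse.  The group \<open>\<langle>'x | R\<rangle>\<close> consists of the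
  classes of words modulo the smallest congruence for concatenation that contains free
  cancellation and identifies every relator with the empty word.
\<close>

type_synonym 'x gword = "('x \<times> bool) list"

inductive pres_eq :: "'x gword set \<Rightarrow> 'x gword \<Rightarrow> 'x gword \<Rightarrow> bool" for R where
  pres_refl: "pres_eq R u u"
| pres_sym: "pres_eq R u v \<Longrightarrow> pres_eq R v u"
| pres_trans: "pres_eq R u v \<Longrightarrow> pres_eq R v w \<Longrightarrow> pres_eq R u w"
| pres_append: "pres_eq R u u' \<Longrightarrow> pres_eq R v v' \<Longrightarrow> pres_eq R (u @ v) (u' @ v')"
| pres_cancel: "pres_eq R [(x, e), (x, \<not> e)] []"
| pres_relator: "r \<in> R \<Longrightarrow> pres_eq R r []"

definition pres_rel :: "'x gword set \<Rightarrow> ('x gword \<times> 'x gword) set" where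
  "pres_rel R = {(u, v). pres_eq R u v}"

definition pres_class :: "'x gword set \<Rightarrow> 'x gword \<Rightarrow> 'x gword set" where
  "pres_class R w = pres_rel R `` {w}"

definition presented_group :: "'x gword set \<Rightarrow> 'x gword set monoid" where
  "presented_group R =
     \<lparr>carrier = UNIV // pres_rel R,
      monoid.mult = (\<lambda>C D. \<Union>u\<in>C. \<Union>v\<in>D. pres_class R (u @ v)),
      one = pres_class R []\<rparr>"

lemma equiv_pres_rel: "equiv UNIV (pres_rel R)"
proof (rule equivI)
  show "sym (pres_rel R)" by (rule symI) (simp add: pres_rel_def pres_sym)
  show "trans (pres_rel R)" by (rule transI) (simp add: pres_rel_def, rule pres_trans)
qed (auto simp: pres_rel_def refl_on_def pres_refl)

lemma pres_class_eq_iff: "pres_class R u = pres_class R v \<longleftrightarrow> pres_eq R u v"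
  unfolding pres_class_def using eq_equiv_class_iff[OF equiv_pres_rel, of u v R]
  by (simp add: pres_rel_def)

lemma carrier_presented_group: "carrier (presented_group R) = range (pres_class R)"
  by (auto simp: presented_group_def quotient_def pres_class_def)

lemma one_presented_group: "\<one>\<^bsub>presented_group R\<^esub> = pres_class R []"
  by (simp add: presented_group_def)

lemma mult_presented_group:
  "pres_class R u \<otimes>\<^bsub>presented_group R\<^esub> pres_class R v = pres_class R (u @ v)"
proof -
  have "pres_class R (u' @ v') = pres_class R (u @ v)"
    if "u' \<in> pres_class R u" "v' \<in> pres_class R v" for u' v'
  proof -
    have "pres_eq R u u'" "pres_eq R v v'"
      using that by (simp_all add: pres_class_def pres_rel_def)
    then show ?thesis by (simp add: pres_class_eq_iff pres_append pres_sym)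
  qed
  moreover have "u \<in> pres_class R u" "v \<in> pres_class R v"
    by (simp_all add: pres_class_def pres_rel_def pres_refl)
  ultimately have "(\<Union>u'\<in>pres_class R u. \<Union>v'\<in>pres_class R v. pres_class R (u' @ v')) =
      pres_class R (u @ v)"
    by blast
  then show ?thesis by (simp add: presented_group_def)
qed

lemma pres_inverse: "pres_eq R (rev (map (\<lambda>(x, e). (x, \<not> e)) w) @ w) []"
proof (induction w)
  case Nil
  show ?case by (simp add: pres_refl)
next
  case (Cons l w)
  obtain x e where l: "l = (x, e)" by force
  let ?v = "rev (map (\<lambda>(x, e). (x, \<not> e)) w)"
  have "pres_eq R [(x, \<not> e), (x, e)] []"
    using pres_cancel[of R x "\<not> e"] by simp
  then have "pres_eq R (?v @ ([(x, \<not> e), (x, e)] @ w)) (?v @ ([] @ w))"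
    by (intro pres_append pres_refl)
  then have "pres_eq R (?v @ ([(x, \<not> e), (x, e)] @ w)) []"
    by (rule pres_trans) (use Cons.IH in simp)
  then show ?case by (simp add: l)
qed

lemma group_presented_group: "group (presented_group R)"
proof (rule groupI)
  fix X assume "X \<in> carrier (presented_group R)"
  then obtain w where w: "X = pres_class R w" by (auto simp: carrier_presented_group)
  show "\<exists>Y\<in>carrier (presented_group R). Y \<otimes>\<^bsub>presented_group R\<^esub> X = \<one>\<^bsub>presented_group R\<^esub>"
    by (rule bexI[of _ "pres_class R (rev (map (\<lambda>(x, e). (x, \<not> e)) w))"])
       (auto simp: w mult_presented_group one_presented_group carrier_presented_group
         pres_class_eq_iff pres_inverse)
qed (auto simp: carrier_presented_group mult_presented_group one_presented_group)


section \<open>The dihedral group\<close>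

datatype dihedral_gen = Gen_a | Gen_b

definition dihedral_relators :: "nat \<Rightarrow> dihedral_gen gword set" where
  "dihedral_relators n =
     {[(Gen_a, False), (Gen_a, False)],
      replicate n (Gen_b, False),
      [(Gen_a, False), (Gen_b, False), (Gen_a, False), (Gen_b, False)]}"

definition dihedral :: "nat \<Rightarrow> dihedral_gen gword set monoid" where
  "dihedral n = presented_group (dihedral_relators n)"

definition dih_a :: "nat \<Rightarrow> dihedral_gen gword set" where
  "dih_a n = pres_class (dihedral_relators n) [(Gen_a, False)]"

definition dih_b :: "nat \<Rightarrow> dihedral_gen gword set" where
  "dih_b n = pres_class (dihedral_relators n) [(Gen_b, False)]"


section \<open>Cayley graphs and spanning trees\<close>

text \<open>
  A simple undirected graph is given by a vertex set \<open>V\<close> and a set \<open>E\<close> of two-element subsets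
  of \<open>V\<close>.  (The trees of \<open>Graph_Theory\<close> are directed, hence unsuitable for counting here.)
\<close>

definition cayley_edges :: "('g, 'm) monoid_scheme \<Rightarrow> 'g set \<Rightarrow> 'g set set" where
  "cayley_edges G S =
     {{g, h} | g h. g \<in> carrier G \<and> h \<in> carrier G \<and> (\<exists>x\<in>S. h = g \<otimes>\<^bsub>G\<^esub> x)}"

definition graph_connected :: "'v set \<Rightarrow> 'v set set \<Rightarrow> bool" where
  "graph_connected V F \<longleftrightarrow>
     V \<noteq> {} \<and> (\<forall>u\<in>V. \<forall>v\<in>V. (u, v) \<in> {(x, y). {x, y} \<in> F}\<^sup>*)"

definition graph_cycle :: "'v set set \<Rightarrow> 'v list \<Rightarrow> bool" where
  "graph_cycle F vs \<longleftrightarrow>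
     3 \<le> length vs \<and> distinct vs \<and>
     (\<forall>i < length vs. {vs ! i, vs ! (Suc i mod length vs)} \<in> F)"

definition spanning_trees :: "'v set \<Rightarrow> 'v set set \<Rightarrow> 'v set set set" where
  "spanning_trees V E =
     {F. F \<subseteq> E \<and> graph_connected V F \<and> \<not> (\<exists>vs. graph_cycle F vs)}"

definition dihedral_connection_set ::
    "nat \<Rightarrow> nat \<Rightarrow> nat \<Rightarrow> (nat \<Rightarrow> int) \<Rightarrow> (nat \<Rightarrow> int) \<Rightarrow> dihedral_gen gword set set" where
  "dihedral_connection_set n s t \<beta> \<gamma> =
     (\<Union>i\<in>{1..s}. {dih_b n [^]\<^bsub>dihedral n\<^esub> \<beta> i, dih_b n [^]\<^bsub>dihedral n\<^esub> (- \<beta> i)}) \<union>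
     (\<Union>i\<in>{1..t}. {dih_a n \<otimes>\<^bsub>dihedral n\<^esub> (dih_b n [^]\<^bsub>dihedral n\<^esub> \<gamma> i)})"

definition num_spanning_trees ::
    "nat \<Rightarrow> nat \<Rightarrow> nat \<Rightarrow> (nat \<Rightarrow> int) \<Rightarrow> (nat \<Rightarrow> int) \<Rightarrow> nat" where
  "num_spanning_trees n s t \<beta> \<gamma> =
     card (spanning_trees (carrier (dihedral n))
       (cayley_edges (dihedral n) (dihedral_connection_set n s t \<beta> \<gamma>)))"


section \<open>Laurent polynomials\<close>

text \<open>
  Finitely supported maps from the additive group of integers, with their convolution product,
  form the ring of Laurent polynomials; \<open>single k 1\<close> is the monomial \<open>z\<^sup>k\<close>.
\<close>

type_synonym laurent_poly = "int \<Rightarrow>\<^sub>0 complex"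

abbreviation laurent_z :: "int \<Rightarrow> laurent_poly" where
  "laurent_z k \<equiv> Poly_Mapping.single k 1"

text \<open>The substitution of \<open>z\<^sup>-\<^sup>1\<close> for \<open>z\<close>.\<close>

definition laurent_inv :: "laurent_poly \<Rightarrow> laurent_poly" where
  "laurent_inv f = Poly_Mapping.map_key uminus f"

definition laurent_A :: "nat \<Rightarrow> nat \<Rightarrow> (nat \<Rightarrow> int) \<Rightarrow> laurent_poly" where
  "laurent_A s t \<beta> = of_nat (2 * s + t) - (\<Sum>i = 1..s. laurent_z (\<beta> i) + laurent_z (- \<beta> i))"

definition laurent_B :: "nat \<Rightarrow> (nat \<Rightarrow> int) \<Rightarrow> laurent_poly" where
  "laurent_B t \<gamma> = - (\<Sum>i = 1..t. laurent_z (\<gamma> i))"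

definition associated_laurent ::
    "nat \<Rightarrow> nat \<Rightarrow> (nat \<Rightarrow> int) \<Rightarrow> (nat \<Rightarrow> int) \<Rightarrow> laurent_poly" where
  "associated_laurent s t \<beta> \<gamma> =
     laurent_A s t \<beta> * laurent_inv (laurent_A s t \<beta>) - laurent_B t \<gamma> * laurent_inv (laurent_B t \<gamma>)"

text \<open>The highest exponent and the leading coefficient are meaningful for nonzero \<open>f\<close> only.\<close>

definition laurent_top :: "laurent_poly \<Rightarrow> int" where
  "laurent_top f = Max (Poly_Mapping.keys f)"

definition laurent_leading :: "laurent_poly \<Rightarrow> complex" where
  "laurent_leading f = Poly_Mapping.lookup f (laurent_top f)"


section \<open>Chebyshev polynomials and the Chebyshev transform\<close>

definition chebyshev_T :: "nat \<Rightarrow> complex poly" where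
  "chebyshev_T n = (THE p. \<forall>x. poly p x = cos (of_nat n * Arccos x))"

lemma chebyshev_T_exists: "\<exists>p. \<forall>x. poly p x = cos (of_nat n * Arccos x)"
proof (induction n rule: less_induct)
  case (less n)
  consider "n = 0" | "n = 1" | m where "n = Suc (Suc m)"
    by (metis One_nat_def not0_implies_Suc)
  then show ?case
  proof cases
    case 1
    then show ?thesis by (intro exI[of _ 1]) simp
  next
    case 2
    then show ?thesis by (intro exI[of _ "[:0, 1:]"]) simp
  next
    case 3
    obtain p q
      where p: "\<forall>x. poly p x = cos (of_nat (Suc m) * Arccos x)"
        and q: "\<forall>x. poly q x = cos (of_nat m * Arccos x)"
      using less.IH[of "Suc m"] less.IH[of m] 3 by auto
    have "2 * x * cos (of_nat (Suc m) * Arccos x) - cos (of_nat m * Arccos x)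
        = cos (of_nat n * Arccos x)" for x
    proof -
      let ?y = "of_nat (Suc m) * Arccos x"
      have "of_nat n * Arccos x = ?y + Arccos x" "of_nat m * Arccos x = ?y - Arccos x"
        by (simp_all add: 3 algebra_simps)
      then show ?thesis by (simp only: cos_add cos_diff cos_Arccos) (simp add: algebra_simps)
    qed
    moreover have "poly ([:0, 2:] * p - q) x = 2 * x * poly p x - poly q x" for x
      by (simp add: algebra_simps)
    ultimately have "\<forall>x. poly ([:0, 2:] * p - q) x = cos (of_nat n * Arccos x)"
      by (simp only: p q) simp
    then show ?thesis by blast
  qed
qed

lemma poly_chebyshev_T: "poly (chebyshev_T n) x = cos (of_nat n * Arccos x)"
proof -
  have "\<exists>!p. \<forall>x. poly p x = cos (of_nat n * Arccos x)"
  proof (rule ex_ex1I[OF chebyshev_T_exists])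
    fix p q :: "complex poly"
    assume "\<forall>x. poly p x = cos (of_nat n * Arccos x)" "\<forall>x. poly q x = cos (of_nat n * Arccos x)"
    then show "p = q" by (simp add: poly_eq_poly_eq_iff[symmetric] fun_eq_iff)
  qed
  from theI'[OF this] show ?thesis by (simp add: chebyshev_T_def)
qed

definition chebyshev_transform :: "laurent_poly \<Rightarrow> complex poly" where
  "chebyshev_transform f =
     [:Poly_Mapping.lookup f 0:] +
     (\<Sum>k = 1..nat (laurent_top f). smult (2 * Poly_Mapping.lookup f (int k)) (chebyshev_T k))"

end

theory Submission
  imports Defs "Jordan_Normal_Form.Determinant"
begin

text \<open>
  The number of spanning trees of a graph on \<open>N\<close> vertices is read off the linear coefficient of
  \<open>det (x I + L)\<close>, where \<open>L\<close> is the Laplacian, and for the dihedral Cayley graph this determinant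
  splits into \<open>n\<close> factors indexed by the \<open>n\<close>-th roots of unity.

  The first half is a version of the matrix-tree theorem (lemma \<open>matrix_tree\<close>).  Row \<open>i\<close> of
  \<open>x I + L\<close> is a sum of elementary rows \<open>e\<^sub>i - e\<^sub>k\<close>, one for each neighbour \<open>k\<close>, and of \<open>x\<close> times
  the row \<open>e\<^sub>i\<close>.  Expanding the determinant by multilinearity amounts to choosing at each vertex
  either a neighbour or to stop at that vertex with weight \<open>x\<close>.  A choice whose walks all stop
  contributes a triangular matrix of determinant 1; any other choice contributes a singular matrix
  (\<open>det_laplacian_mat\<close>).  So \<open>det (x I + L)\<close> counts spanning forests with one root in each
  component, weighted by \<open>x\<close> to the number of roots, and its linear coefficient is \<open>N\<close> times the
  number of spanning trees (\<open>parent_maps_bij_spanning_trees\<close>).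

  For the second half, write the group elements as \<open>b\<^sup>k\<close> and \<open>b\<^sup>k a\<close>.  With this choice of normal form
  right multiplication by \<open>b\<^sup>m\<close> and by \<open>a b\<^sup>m\<close> shifts the exponent \<open>k\<close>, so that \<open>L\<close> consists of four
  circulant blocks.  The discrete Fourier transform diagonalises all four at once, and the
  determinant becomes the product over \<open>\<zeta>\<^sup>n = 1\<close> of
  \<open>(x + \<A>(\<zeta>))\<^sup>2 - \<B>(\<zeta>) \<B>(1/\<zeta>)\<close>.  The factor at \<open>\<zeta> = 1\<close> is \<open>x (x + 2 t)\<close>, whence
  \<open>n \<tau> = t \<Prod>\<^bsub>\<zeta> \<noteq> 1\<^esub> P(\<zeta>)\<close> (\<open>dihedral_spanning_trees_product\<close>).

  It remains to evaluate this product through the roots of \<open>Q\<close>.  As \<open>P(\<zeta>) = Q((\<zeta> + 1/\<zeta>)/2)\<close>, one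
  swaps the product over \<open>\<zeta>\<close> with the product over the roots \<open>w\<close> and uses
  \<open>\<Prod>\<^bsub>\<zeta>\<^esub> \<bar>\<zeta> + 1/\<zeta> - 2 w\<bar> = \<bar>2 T(n, w) - 2\<bar>\<close>.  The root \<open>w = 1\<close> is simple because \<open>Q'(1)\<close> is the
  second moment \<open>\<Sum>k\<^sup>2 c\<^sub>k\<close> of the coefficients of \<open>P\<close>, which equals \<open>-2 q\<close>; this root contributes
  \<open>\<Prod>\<^bsub>\<zeta> \<noteq> 1\<^esub> \<bar>\<zeta> + 1/\<zeta> - 2\<bar> = n\<^sup>2\<close>.  The factors at \<open>\<zeta> = 1\<close> missing for the other roots multiply to
  \<open>\<Prod>\<bar>2 - 2 w\<bar> = q / \<bar>\<eta>\<bar>\<close>, again by the value of \<open>Q'(1)\<close> (\<open>prod_over_unity_roots\<close>).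
\<close>

section \<open>Spanning trees as parent maps\<close>

definition edge_rel :: "'v set set \<Rightarrow> ('v \<times> 'v) set" where
  "edge_rel F = {(x, y). {x, y} \<in> F}"

lemma sym_edge_rel: "sym (edge_rel F)"
  by (auto simp: sym_def edge_rel_def insert_commute)

lemma rtrancl_imp_distinct_path:
  assumes "(x, y) \<in> R\<^sup>*"
  obtains xs where "xs \<noteq> []" "hd xs = x" "last xs = y" "distinct xs"
    "successively (\<lambda>a b. (a, b) \<in> R) xs"
proof -
  have "\<exists>xs. xs \<noteq> [] \<and> hd xs = x \<and> last xs = y \<and> distinct xs \<and>
      successively (\<lambda>a b. (a, b) \<in> R) xs"
    using assms
  proof (induction rule: rtrancl_induct)
    case base
    show ?case by (intro exI[of _ "[x]"]) simp
  next
    case (step y z)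
    then obtain xs where xs: "xs \<noteq> []" "hd xs = x" "last xs = y" "distinct xs"
      "successively (\<lambda>a b. (a, b) \<in> R) xs" by blast
    show ?case
    proof (cases "z \<in> set xs")
      case True
      then obtain us ws where split: "xs = us @ z # ws" by (meson split_list)
      then have "successively (\<lambda>a b. (a, b) \<in> R) (us @ [z])" "hd (us @ [z]) = hd xs"
        using xs(5) by (simp_all add: successively_append_iff hd_append)
      then show ?thesis
        using xs(2,4) split by (intro exI[of _ "us @ [z]"]) simp
    next
      case False
      then show ?thesis
        using xs step.hyps by (intro exI[of _ "xs @ [z]"]) (auto simp: successively_append_iff)
    qed
  qed
  then show thesis using that by blast
qed

definition simple_graph_on :: "'v set \<Rightarrow> 'v set set \<Rightarrow> bool" where
  "simple_graph_on V E \<longleftrightarrow> (\<forall>e\<in>E. \<exists>u\<in>V. \<exists>v\<in>V. u \<noteq> v \<and> e = {u, v})"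

lemma simple_graph_onD:
  assumes "simple_graph_on V E" "{u, v} \<in> E"
  shows "u \<in> V" "v \<in> V" "u \<noteq> v"
  using assms unfolding simple_graph_on_def by (auto simp: doubleton_eq_iff)

text \<open>
  An edge outside the connected subgraph would close a simple path of the subgraph to a cycle.
  The path has at least three vertices precisely because its end points are distinct and the
  closing edge is not one of its steps.
\<close>

lemma connected_subgraph_of_acyclic_eq:
  assumes E: "simple_graph_on V F"
    and acyclic: "\<not> (\<exists>vs. graph_cycle F vs)"
    and sub: "F' \<subseteq> F" and conn: "graph_connected V F'"
  shows "F' = F"
proof (rule ccontr)
  assume "F' \<noteq> F"
  then obtain e where e: "e \<in> F" "e \<notin> F'" using sub by blast
  then obtain x y where xy: "x \<in> V" "y \<in> V" "x \<noteq> y" "e = {x, y}"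
    using E unfolding simple_graph_on_def by blast
  then have "(x, y) \<in> (edge_rel F')\<^sup>*"
    using conn by (simp add: graph_connected_def edge_rel_def)
  then obtain xs where xs: "xs \<noteq> []" "hd xs = x" "last xs = y" "distinct xs"
    and steps: "successively (\<lambda>a b. (a, b) \<in> edge_rel F') xs"
    by (rule rtrancl_imp_distinct_path)
  have "length xs \<noteq> 1"
    using xs xy by (auto simp: length_Suc_conv)
  moreover have "length xs \<noteq> 2"
    using xs xy e steps by (auto simp: length_Suc_conv numeral_2_eq_2 edge_rel_def)
  ultimately have "3 \<le> length xs"
    using xs(1) by (cases "length xs") (auto simp: numeral_eq_Suc)
  moreover have "{xs ! i, xs ! (Suc i mod length xs)} \<in> F" if i: "i < length xs" for i
  proof (cases "Suc i < length xs")
    case True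
    then show ?thesis
      using steps sub by (auto simp: successively_conv_nth edge_rel_def)
  next
    case False
    then have "Suc i = length xs" using i by simp
    then have "{xs ! i, xs ! (Suc i mod length xs)} = {last xs, hd xs}"
      using xs(1) by (simp add: last_conv_nth hd_conv_nth flip: \<open>Suc i = length xs\<close>)
    then show ?thesis using xs xy e by (simp add: insert_commute)
  qed
  ultimately have "graph_cycle F xs" using xs(4) by (simp add: graph_cycle_def)
  then show False using acyclic by blast
qed

text \<open>
  A spanning tree rooted at \<open>r\<close> is encoded by sending each other vertex to the next vertex on its
  path to \<open>r\<close>.  That iterating the map leads to \<open>r\<close> is expressed by a height function \<open>d\<close> which
  decreases along it; the same device serves below to show that a matrix is triangular.
\<close>

definition parent_maps :: "'v set \<Rightarrow> 'v set set \<Rightarrow> 'v \<Rightarrow> ('v \<Rightarrow> 'v) set" where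
  "parent_maps V E r =
     {f \<in> (V - {r}) \<rightarrow>\<^sub>E V. (\<forall>v\<in>V - {r}. {v, f v} \<in> E) \<and>
        (\<exists>d :: 'v \<Rightarrow> nat. \<forall>v\<in>V - {r}. d (f v) < d v)}"

definition parent_edges :: "'v set \<Rightarrow> 'v \<Rightarrow> ('v \<Rightarrow> 'v) \<Rightarrow> 'v set set" where
  "parent_edges V r f = (\<lambda>v. {v, f v}) ` (V - {r})"

lemma parent_edges_connected:
  assumes r: "r \<in> V" and f: "f \<in> (V - {r}) \<rightarrow> V"
    and d: "\<forall>v\<in>V - {r}. d (f v) < (d v :: nat)"
  shows "graph_connected V (parent_edges V r f)"
proof -
  let ?R = "edge_rel (parent_edges V r f)"
  have to_root: "(v, r) \<in> ?R\<^sup>*" if "v \<in> V" for v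
    using that
  proof (induction "d v" arbitrary: v rule: less_induct)
    case less
    show ?case
    proof (cases "v = r")
      case False
      then have "(v, f v) \<in> ?R" using less.prems by (auto simp: edge_rel_def parent_edges_def)
      moreover have "(f v, r) \<in> ?R\<^sup>*"
        using False less.prems f d by (intro less.hyps) auto
      ultimately show ?thesis by (rule converse_rtrancl_into_rtrancl)
    qed simp
  qed
  have "(u, v) \<in> ?R\<^sup>*" if "u \<in> V" "v \<in> V" for u v
    using to_root[OF that(1)] to_root[OF that(2)] sym_edge_rel
    by (meson rtrancl_trans symD sym_rtrancl)
  then show ?thesis using r by (auto simp: graph_connected_def edge_rel_def)
qed

text \<open>
  At a vertex of greatest height on a cycle, both neighbours on the cycle lie below it and are
  therefore its parent; but they are different vertices.
\<close>

lemma parent_edges_acyclic: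
  assumes d: "\<forall>v\<in>V - {r}. d (f v) < (d v :: nat)"
  shows "\<not> graph_cycle (parent_edges V r f) vs"
proof
  assume cycle: "graph_cycle (parent_edges V r f) vs"
  let ?m = "length vs"
  have m: "3 \<le> ?m" and dist: "distinct vs"
    and edge: "\<And>i. i < ?m \<Longrightarrow> {vs ! i, vs ! (Suc i mod ?m)} \<in> parent_edges V r f"
    using cycle by (auto simp: graph_cycle_def)
  have "Max (d ` set vs) \<in> d ` set vs" using m by (intro Max_in) auto
  then obtain i where i: "i < ?m" and dmax: "d (vs ! i) = Max (d ` set vs)"
    by (metis imageE in_set_conv_nth)
  have top: "d (vs ! k) \<le> d (vs ! i)" if "k < ?m" for k
    unfolding dmax using that by (intro Max_ge) auto
  have up: "y = f x" if xy: "{x, y} \<in> parent_edges V r f" and le: "d y \<le> d x" for x y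
  proof -
    obtain v where v: "v \<in> V - {r}" "{x, y} = {v, f v}"
      using xy unfolding parent_edges_def by blast
    then have "d (f v) < d v" using d by blast
    then show ?thesis using v(2) le by (auto simp: doubleton_eq_iff)
  qed
  define j where "j = (if i = 0 then ?m - 1 else i - 1)"
  define k where "k = Suc i mod ?m"
  have j: "j < ?m" "Suc j mod ?m = i" and k: "k < ?m"
    using i m by (auto simp: j_def k_def intro: mod_less_divisor)
  have "j \<noteq> k"
    using i m by (cases "Suc i = ?m") (auto simp: j_def k_def)
  moreover have "vs ! k = f (vs ! i)"
    using edge[OF i] top[OF k] by (intro up) (auto simp: k_def)
  moreover have "vs ! j = f (vs ! i)"
    using edge[OF j(1)] top[OF j(1)] j(2) by (intro up) (auto simp: insert_commute)
  ultimately show False using dist j(1) k by (metis nth_eq_iff_index_eq)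
qed

text \<open>
  If the parent \<open>f v\<close> is not \<open>g v\<close>, the edge between \<open>v\<close> and \<open>f v\<close> must be used by \<open>g\<close> in the opposite
  direction.  By induction on the height \<open>f\<close> agrees with \<open>g\<close> at \<open>f v\<close>, so \<open>f\<close> would map \<open>f v\<close> back up
  to \<open>v\<close>.
\<close>

lemma parent_edges_determine_parents:
  assumes f: "f \<in> (V - {r}) \<rightarrow> V" and d: "\<forall>v\<in>V - {r}. d (f v) < (d v :: nat)"
    and eq: "parent_edges V r f = parent_edges V r g"
    and v: "v \<in> V - {r}"
  shows "g v = f v"
  using v
proof (induction "d v" arbitrary: v rule: less_induct)
  case less
  have "{v, f v} \<in> parent_edges V r g"
    unfolding eq[symmetric] using less.prems by (auto simp: parent_edges_def)
  then obtain w where "w \<in> V - {r}" "{v, f v} = {w, g w}"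
    unfolding parent_edges_def by blast
  then consider "g v = f v" | "f v \<in> V - {r}" "g (f v) = v"
    by (metis doubleton_eq_iff)
  then show ?case
  proof cases
    case 2
    have "d (f v) < d v" using d less.prems by blast
    then have "f (f v) = v" using less.hyps[of "f v"] 2 by simp
    then have "d v < d (f v)" using d 2(1) by metis
    then show ?thesis using \<open>d (f v) < d v\<close> by simp
  qed
qed

text \<open>
  For surjectivity, take the distance to the root as height function of a spanning tree.  Choosing
  one edge from each vertex to a strictly closer one already gives a connected subgraph, hence the
  whole tree.
\<close>

theorem parent_maps_bij_spanning_trees:
  assumes E: "simple_graph_on V E" and r: "r \<in> V"
  shows "bij_betw (parent_edges V r) (parent_maps V E r) (spanning_trees V E)"
proof (rule bij_betwI')
  fix f g
  assume f: "f \<in> parent_maps V E r" and g: "g \<in> parent_maps V E r"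
  show "parent_edges V r f = parent_edges V r g \<longleftrightarrow> f = g"
  proof
    assume eq: "parent_edges V r f = parent_edges V r g"
    obtain d :: "'a \<Rightarrow> nat" where d: "\<forall>v\<in>V - {r}. d (f v) < d v"
      using f by (auto simp: parent_maps_def)
    have fV: "f \<in> (V - {r}) \<rightarrow>\<^sub>E V" and gV: "g \<in> (V - {r}) \<rightarrow>\<^sub>E V"
      using f g by (auto simp: parent_maps_def)
    show "f = g"
      using fV gV
    proof (rule PiE_ext)
      fix v assume "v \<in> V - {r}"
      then show "f v = g v"
        using parent_edges_determine_parents[OF _ d eq] fV by (auto simp: PiE_def)
    qed
  qed simp
next
  fix f assume f: "f \<in> parent_maps V E r"
  then obtain d :: "'a \<Rightarrow> nat" where d: "\<forall>v\<in>V - {r}. d (f v) < d v"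
    by (auto simp: parent_maps_def)
  have "parent_edges V r f \<subseteq> E" using f by (auto simp: parent_maps_def parent_edges_def)
  moreover have "graph_connected V (parent_edges V r f)"
    using f by (intro parent_edges_connected[OF r _ d]) (auto simp: parent_maps_def)
  ultimately show "parent_edges V r f \<in> spanning_trees V E"
    using parent_edges_acyclic[OF d] by (simp add: spanning_trees_def)
next
  fix F assume F: "F \<in> spanning_trees V E"
  then have sub: "F \<subseteq> E" and conn: "graph_connected V F"
    and acyclic: "\<not> (\<exists>vs. graph_cycle F vs)"
    by (auto simp: spanning_trees_def)
  have simple: "simple_graph_on V F" using E sub by (auto simp: simple_graph_on_def)
  \<comment> \<open>The distance to the root.\<close>
  define d where "d v = (LEAST k. (v, r) \<in> edge_rel F ^^ k)" for v
  have closer: "\<exists>u. {v, u} \<in> F \<and> d u < d v" if v: "v \<in> V - {r}" for v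
  proof -
    have "(v, r) \<in> (edge_rel F)\<^sup>*"
      using conn v r by (auto simp: graph_connected_def edge_rel_def)
    then have least: "(v, r) \<in> edge_rel F ^^ d v"
      unfolding d_def by (metis LeastI rtrancl_power)
    moreover have "d v \<noteq> 0" using least v by (metis DiffD2 relpow_0_E singletonI)
    ultimately obtain k where k: "d v = Suc k" "(v, r) \<in> edge_rel F ^^ Suc k"
      by (metis not0_implies_Suc)
    then obtain u where u: "(v, u) \<in> edge_rel F" "(u, r) \<in> edge_rel F ^^ k"
      by (meson relpow_Suc_D2)
    have "d u \<le> k" unfolding d_def using u(2) by (rule Least_le)
    then show ?thesis using u(1) k(1) by (auto simp: edge_rel_def)
  qed
  define f where "f = (\<lambda>v\<in>V - {r}. SOME u. {v, u} \<in> F \<and> d u < d v)"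
  have f: "{v, f v} \<in> F" "d (f v) < d v" if "v \<in> V - {r}" for v
    using someI_ex[OF closer[OF that]] that by (simp_all add: f_def)
  have fV: "f \<in> (V - {r}) \<rightarrow>\<^sub>E V"
    using simple_graph_onD(2)[OF simple f(1)] by (auto simp: f_def)
  have d: "\<forall>v\<in>V - {r}. d (f v) < d v" using f(2) by blast
  have "parent_edges V r f = F"
  proof (rule connected_subgraph_of_acyclic_eq[OF simple acyclic])
    show "parent_edges V r f \<subseteq> F" using f(1) by (auto simp: parent_edges_def)
    show "graph_connected V (parent_edges V r f)"
      using fV by (intro parent_edges_connected[OF r _ d]) auto
  qed
  moreover have "f \<in> parent_maps V E r"
    using fV d f(1) sub by (auto simp: parent_maps_def)
  ultimately show "\<exists>f\<in>parent_maps V E r. F = parent_edges V r f" by blast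
qed

section \<open>The determinant of a Laplacian as a sum over rooted maps\<close>

text \<open>
  The value \<open>N\<close>, which is not an index, means that a walk stops.  Beyond the indices the maps are the
  identity, to agree with the summation range in the multilinear expansion of a determinant.
\<close>

definition rooted_maps :: "nat \<Rightarrow> (nat \<Rightarrow> nat) set" where
  "rooted_maps N = {f. (\<forall>i<N. f i \<le> N) \<and> (\<forall>i\<ge>N. f i = i) \<and>
     (\<exists>d :: nat \<Rightarrow> nat. \<forall>i<N. f i < N \<longrightarrow> d (f i) < d i)}"

text \<open>
  The row of a Laplacian that belongs to a single arc from \<open>i\<close> to \<open>k\<close>.  For \<open>k = N\<close> the second term
  vanishes and the row is the unit vector at \<open>i\<close>.
\<close>

definition arc_vec :: "nat \<Rightarrow> nat \<Rightarrow> nat \<Rightarrow> 'a :: comm_ring_1 vec" where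
  "arc_vec N i k = Matrix.vec N (\<lambda>j. of_bool (i = j) - of_bool (k = j))"

lemma finite_index_maps:
  "finite {f. (\<forall>i\<in>{0..<N}. f i \<in> {..N}) \<and> (\<forall>i. i \<notin> {0..<N} \<longrightarrow> f i = (i :: nat))}"
  (is "finite ?F")
proof -
  have "?F \<subseteq> (\<lambda>g i. if i \<in> {0..<N} then g i else i) ` ({0..<N} \<rightarrow>\<^sub>E {..N})"
  proof
    fix f assume f: "f \<in> ?F"
    then have "restrict f {0..<N} \<in> {0..<N} \<rightarrow>\<^sub>E {..N}" by auto
    moreover have "f = (\<lambda>i. if i \<in> {0..<N} then restrict f {0..<N} i else i)"
      using f by (auto simp: fun_eq_iff)
    ultimately show "f \<in> (\<lambda>g i. if i \<in> {0..<N} then g i else i) ` ({0..<N} \<rightarrow>\<^sub>E {..N})"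
      by (intro image_eqI[where x = "restrict f {0..<N}"])
  qed
  then show ?thesis by (rule finite_subset) (simp add: finite_PiE)
qed

lemma finite_rooted_maps: "finite (rooted_maps N)"
  by (rule finite_subset[OF _ finite_index_maps[of N]]) (auto simp: rooted_maps_def)

text \<open>
  In the Leibniz formula a permutation contributes only if it moves every index to itself or to its
  image under \<open>f\<close>.  Since \<open>f\<close> lowers the height and a permutation preserves the sum of all heights,
  only the identity is left.
\<close>

lemma det_arcs_rooted:
  assumes f: "f \<in> rooted_maps N"
  shows "Determinant.det (mat\<^sub>r N N (\<lambda>i. arc_vec N i (f i))) = (1 :: 'a :: idom)"
proof -
  let ?M = "mat\<^sub>r N N (\<lambda>i. arc_vec N i (f i)) :: 'a mat"
  obtain d :: "nat \<Rightarrow> nat" where d: "\<And>i. i < N \<Longrightarrow> f i < N \<Longrightarrow> d (f i) < d i"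
    using f by (auto simp: rooted_maps_def)
  have M: "?M \<in> carrier_mat N N" by simp
  have entry: "?M $$ (i, j) = of_bool (i = j) - of_bool (f i = j)" if "i < N" "j < N" for i j
    using that by (simp add: arc_vec_def)
  have zero: "(\<Prod>i = 0..<N. ?M $$ (i, p i)) = 0" if p: "p permutes {0..<N}" "p \<noteq> id" for p
  proof (rule ccontr)
    assume "(\<Prod>i = 0..<N. ?M $$ (i, p i)) \<noteq> 0"
    then have nz: "?M $$ (i, p i) \<noteq> 0" if "i < N" for i
      using that by simp
    have pN: "p i < N" if "i < N" for i using permutes_in_image[OF p(1), of i] that by simp
    have step: "p i = i \<or> p i = f i" if "i < N" for i
      using nz[OF that] entry[OF that pN[OF that]] by auto
    obtain i where "p i \<noteq> i" using p(2) by (auto simp: fun_eq_iff)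
    moreover have "i < N" using calculation permutes_not_in[OF p(1), of i] by fastforce
    ultimately have i: "i < N" "p i = f i" "p i \<noteq> i" using step by auto
    have "(\<Sum>i = 0..<N. d (p i)) < (\<Sum>i = 0..<N. d i)"
    proof (rule sum_strict_mono_ex1)
      show "\<forall>i\<in>{0..<N}. d (p i) \<le> d i"
      proof
        fix i assume "i \<in> {0..<N}"
        then show "d (p i) \<le> d i" using step[of i] d[of i] pN[of i] by fastforce
      qed
      show "\<exists>i\<in>{0..<N}. d (p i) < d i"
        using i d[of i] pN[of i] by (intro bexI[of _ i]) auto
    qed simp
    moreover have "(\<Sum>i = 0..<N. d (p i)) = (\<Sum>i = 0..<N. d i)"
      using sum.permute[OF p(1), of d] by (simp add: o_def)
    ultimately show False by simp
  qed
  have "Determinant.det ?M = (\<Sum>p\<in>{id}. signof p * (\<Prod>i = 0..<N. ?M $$ (i, p i)))"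
    unfolding det_def'[OF M]
  proof (rule sum.mono_neutral_right)
    show "\<forall>p\<in>{p. p permutes {0..<N}} - {id}. signof p * (\<Prod>i = 0..<N. ?M $$ (i, p i)) = 0"
      using zero by simp
  qed (auto simp: permutes_id finite_permutations)
  also have "\<dots> = (\<Prod>i = 0..<N. ?M $$ (i, i))" by simp
  also have "\<dots> = 1"
  proof (rule prod.neutral, rule)
    fix i assume "i \<in> {0..<N}"
    then show "?M $$ (i, i) = 1"
      using d[of i] entry[of i i] by (cases "f i = i") auto
  qed
  finally show ?thesis .
qed

text \<open>
  The indices whose walk never stops form a nonempty set that contains \<open>i\<close> if and only if it
  contains \<open>f i\<close>.  Its indicator vector is therefore annihilated by every row.
\<close>

lemma det_arcs_unrooted:
  assumes f: "\<And>i. i < N \<Longrightarrow> f i \<le> N" "\<And>i. i \<ge> N \<Longrightarrow> f i = i"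
    and "f \<notin> rooted_maps N"
  shows "Determinant.det (mat\<^sub>r N N (\<lambda>i. arc_vec N i (f i))) = (0 :: 'a :: idom)"
proof -
  let ?M = "mat\<^sub>r N N (\<lambda>i. arc_vec N i (f i)) :: 'a mat"
  \<comment> \<open>The indices whose walk never stops.\<close>
  define C where "C = {i. \<forall>k. (f ^^ k) i < N}"
  have C_sub: "i < N" if "i \<in> C" for i
    using that by (auto simp: C_def dest: spec[of _ 0])
  have C_step: "i \<in> C \<longleftrightarrow> f i \<in> C" if "i < N" for i
  proof -
    have "(\<forall>k. (f ^^ k) i < N) \<longleftrightarrow> (\<forall>k. (f ^^ Suc k) i < N)"
    proof (intro iffI allI)
      fix k assume "\<forall>k. (f ^^ Suc k) i < N"
      then show "(f ^^ k) i < N" using that by (cases k) auto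
    qed blast
    then show ?thesis by (simp add: C_def funpow_swap1 del: funpow.simps(2) add: funpow_Suc_right)
  qed
  have "C \<noteq> {}"
  proof
    assume empty: "C = {}"
    define d where "d i = (LEAST k. \<not> (f ^^ k) i < N)" for i
    have "d (f i) < d i" if i: "i < N" "f i < N" for i
    proof -
      have "\<exists>k. \<not> (f ^^ k) i < N" using empty by (auto simp: C_def)
      then have least: "\<not> (f ^^ d i) i < N" unfolding d_def by (rule LeastI_ex)
      have "d i \<noteq> 0" using least i by (metis funpow_0)
      then obtain k where k: "d i = Suc k" by (metis not0_implies_Suc)
      have "\<not> (f ^^ k) (f i) < N" using least by (simp add: k funpow_swap1)
      then have "d (f i) \<le> k" unfolding d_def by (rule Least_le)
      then show ?thesis using k by simp
    qed
    then have "f \<in> rooted_maps N" using f by (auto simp: rooted_maps_def)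
    then show False using assms(3) by simp
  qed
  then obtain c where c: "c \<in> C" by blast
  define v :: "'a vec" where "v = Matrix.vec N (\<lambda>i. of_bool (i \<in> C))"
  have v: "v \<in> carrier_vec N" by (simp add: v_def)
  have "vec_index v c \<noteq> vec_index (0\<^sub>v N) c" using c C_sub by (simp add: v_def)
  then have "v \<noteq> 0\<^sub>v N" by metis
  moreover have "?M *\<^sub>v v = 0\<^sub>v N"
  proof (rule eq_vecI)
    fix i assume "i < dim_vec (0\<^sub>v N :: 'a vec)"
    then have i: "i < N" by simp
    have "vec_index (?M *\<^sub>v v) i =
        (\<Sum>j = 0..<N. (of_bool (i = j) - of_bool (f i = j)) * of_bool (j \<in> C))"
      using i by (simp add: scalar_prod_def v_def arc_vec_def)
    also have "\<dots> = (\<Sum>j = 0..<N. if j = i then of_bool (j \<in> C) else 0) -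
        (\<Sum>j = 0..<N. if j = f i then of_bool (j \<in> C) else 0)"
      unfolding left_diff_distrib sum_subtractf
      by (intro arg_cong2[where f = "(-)"] sum.cong) auto
    also have "\<dots> = of_bool (i \<in> C) - of_bool (f i \<in> C)"
      using i C_sub[of "f i"] by (auto simp: sum.delta)
    also have "\<dots> = 0" using C_step[OF i] by simp
    finally show "vec_index (?M *\<^sub>v v) i = vec_index (0\<^sub>v N) i" using i by simp
  qed simp
  ultimately show ?thesis
    using det_0_iff_vec_prod_zero[of ?M N] v by auto
qed

definition laplacian_mat :: "nat \<Rightarrow> (nat \<Rightarrow> nat \<Rightarrow> 'a) \<Rightarrow> 'a :: comm_ring_1 \<Rightarrow> 'a mat" where
  "laplacian_mat N w x =
     Matrix.mat N N (\<lambda>(i, j). of_bool (i = j) * (x + (\<Sum>k<N. w i k)) - w i j)"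

text \<open>
  Each row is the sum of the arcs leaving its index, where the arc to \<open>N\<close> carries the weight \<open>x\<close>;
  multilinearity in the rows then leaves one determinant of arcs for each choice of arcs.
\<close>

theorem det_laplacian_mat:
  fixes w :: "nat \<Rightarrow> nat \<Rightarrow> 'a :: idom"
  shows "Determinant.det (laplacian_mat N w x) =
    (\<Sum>f\<in>rooted_maps N. \<Prod>i<N. if f i = N then x else w i (f i))"
proof -
  define c where "c i k = (if k = N then x else w i k)" for i k
  define a where "a i k = c i k \<cdot>\<^sub>v arc_vec N i k" for i k
  let ?F = "{f. (\<forall>i\<in>{0..<N}. f i \<in> {..N}) \<and> (\<forall>i. i \<notin> {0..<N} \<longrightarrow> f i = i)}"
  have a_carrier: "a \<in> {0..<N} \<rightarrow> {..N} \<rightarrow> carrier_vec N"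
    by (auto simp: a_def arc_vec_def)
  have "laplacian_mat N w x = mat\<^sub>r N N (\<lambda>i. finsum_vec TYPE('a) N (a i) {..N})"
  proof (rule eq_matI)
    fix i j
    assume "i < dim_row (mat\<^sub>r N N (\<lambda>i. finsum_vec TYPE('a) N (a i) {..N}))"
      and "j < dim_col (mat\<^sub>r N N (\<lambda>i. finsum_vec TYPE('a) N (a i) {..N}))"
    then have ij: "i < N" "j < N" by simp_all
    have "mat\<^sub>r N N (\<lambda>i. finsum_vec TYPE('a) N (a i) {..N}) $$ (i, j) =
        vec_index (finsum_vec TYPE('a) N (a i) {..N}) j"
      using ij by simp
    also have "\<dots> = (\<Sum>k\<le>N. vec_index (a i k) j)"
      using ij a_carrier by (subst index_finsum_vec) auto
    also have "\<dots> = (\<Sum>k\<le>N. c i k * of_bool (i = j)) - (\<Sum>k\<le>N. c i k * of_bool (k = j))"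
      using ij by (simp add: a_def arc_vec_def right_diff_distrib sum_subtractf)
    also have "(\<Sum>k\<le>N. c i k * of_bool (k = j)) = (\<Sum>k\<le>N. if k = j then c i k else 0)"
      by (intro sum.cong) auto
    also have "\<dots> = w i j"
      using ij by (simp add: c_def)
    also have "(\<Sum>k\<le>N. c i k * of_bool (i = j)) = of_bool (i = j) * (x + (\<Sum>k<N. w i k))"
      by (simp add: c_def lessThan_Suc_atMost[symmetric] add.commute flip: sum_distrib_right)
    finally show "laplacian_mat N w x $$ (i, j) =
        mat\<^sub>r N N (\<lambda>i. finsum_vec TYPE('a) N (a i) {..N}) $$ (i, j)"
      using ij by (simp add: laplacian_mat_def)
  qed (simp_all add: laplacian_mat_def)
  then have "Determinant.det (laplacian_mat N w x) =
      (\<Sum>f\<in>?F. Determinant.det (mat\<^sub>r N N (\<lambda>i. a i (f i))))"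
    using det_linear_rows_sum[OF _ a_carrier] by simp
  also have "\<dots> = (\<Sum>f\<in>?F. (\<Prod>i<N. c i (f i)) *
      Determinant.det (mat\<^sub>r N N (\<lambda>i. arc_vec N i (f i))))"
  proof (rule sum.cong)
    fix f
    have "(\<lambda>i. arc_vec N i (f i)) \<in> {0..<N} \<rightarrow> carrier_vec N" by (simp add: arc_vec_def)
    from det_rows_mul[OF this, of "\<lambda>i. c i (f i)"]
    show "Determinant.det (mat\<^sub>r N N (\<lambda>i. a i (f i))) =
        (\<Prod>i<N. c i (f i)) * Determinant.det (mat\<^sub>r N N (\<lambda>i. arc_vec N i (f i)))"
      by (simp add: a_def lessThan_atLeast0)
  qed simp
  also have "\<dots> = (\<Sum>f\<in>rooted_maps N. (\<Prod>i<N. c i (f i)))"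
  proof (rule sum.mono_neutral_cong_right)
    show "finite ?F" by (rule finite_index_maps)
    show "rooted_maps N \<subseteq> ?F" by (auto simp: rooted_maps_def)
    show "\<forall>f\<in>?F - rooted_maps N.
        (\<Prod>i<N. c i (f i)) * Determinant.det (mat\<^sub>r N N (\<lambda>i. arc_vec N i (f i))) = 0"
    proof
      fix f assume "f \<in> ?F - rooted_maps N"
      then have "Determinant.det (mat\<^sub>r N N (\<lambda>i. arc_vec N i (f i))) = (0 :: 'a)"
        by (intro det_arcs_unrooted) auto
      then show "(\<Prod>i<N. c i (f i)) * Determinant.det (mat\<^sub>r N N (\<lambda>i. arc_vec N i (f i))) = 0"
        by simp
    qed
  qed (simp add: det_arcs_rooted)
  finally show ?thesis by (simp add: c_def)
qed

section \<open>The matrix-tree theorem\<close>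

text \<open>
  An index of least height has nowhere to go but to stop.
\<close>

lemma exists_root:
  assumes f: "f \<in> rooted_maps N" and N: "0 < N"
  shows "\<exists>i<N. f i = N"
proof -
  obtain d :: "nat \<Rightarrow> nat" where d: "\<And>i. i < N \<Longrightarrow> f i < N \<Longrightarrow> d (f i) < d i"
    using f by (auto simp: rooted_maps_def)
  obtain i where i: "i < N" "\<And>j. j < N \<Longrightarrow> d i \<le> d j"
    using ex_has_least_nat[of "\<lambda>i. i < N" 0 d] N by auto
  have "\<not> f i < N" using i d[of i] by (meson leD)
  moreover have "f i \<le> N" using f i(1) by (simp add: rooted_maps_def)
  ultimately show ?thesis using i(1) by (intro exI[of _ i]) simp
qed

definition graph_rooted_maps :: "nat \<Rightarrow> (nat \<Rightarrow> 'v) \<Rightarrow> 'v set set \<Rightarrow> (nat \<Rightarrow> nat) set" where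
  "graph_rooted_maps N \<nu> E = {f \<in> rooted_maps N. \<forall>i<N. f i < N \<longrightarrow> {\<nu> i, \<nu> (f i)} \<in> E}"

text \<open>
  Both sides count the same trees: the indices are turned into vertices by \<open>\<nu>\<close>, and the root, which
  carries the value \<open>N\<close> on the left, is left out of the domain on the right.
\<close>

lemma card_graph_rooted_maps_root:
  assumes \<nu>: "bij_betw \<nu> {..<N} V" and r: "r < N"
  shows "card {f \<in> graph_rooted_maps N \<nu> E. {i. i < N \<and> f i = N} = {r}} =
    card (parent_maps V E (\<nu> r))"
proof -
  define \<iota> where "\<iota> = inv_into {..<N} \<nu>"
  have \<iota>: "\<iota> v < N" "\<nu> (\<iota> v) = v" if "v \<in> V" for v
    using bij_betw_inv_into_right[OF \<nu> that] bij_betwE[OF bij_betw_inv_into[OF \<nu>]] that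
    by (simp_all add: \<iota>_def)
  have \<iota>\<nu>: "\<iota> (\<nu> i) = i" if "i < N" for i
    using \<nu> that by (simp add: \<iota>_def bij_betw_inv_into_left)
  have \<nu>V: "\<nu> i \<in> V" if "i < N" for i
    using bij_betwE[OF \<nu>] that by simp
  have \<nu>_inj: "\<nu> i = \<nu> j \<longleftrightarrow> i = j" if "i < N" "j < N" for i j
    using \<iota>\<nu> that by metis
  define to_parents where "to_parents f = (\<lambda>v\<in>V - {\<nu> r}. \<nu> (f (\<iota> v)))" for f :: "nat \<Rightarrow> nat"
  define of_parents where
    "of_parents g i = (if i < N then if i = r then N else \<iota> (g (\<nu> i)) else i)" for g i
  have "bij_betw to_parents {f \<in> graph_rooted_maps N \<nu> E. {i. i < N \<and> f i = N} = {r}}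
      (parent_maps V E (\<nu> r))"
  proof (rule bij_betw_byWitness[where f' = of_parents])
    show "\<forall>f\<in>{f \<in> graph_rooted_maps N \<nu> E. {i. i < N \<and> f i = N} = {r}}.
        of_parents (to_parents f) = f"
    proof (intro ballI ext)
      fix f i assume "f \<in> {f \<in> graph_rooted_maps N \<nu> E. {i. i < N \<and> f i = N} = {r}}"
      then have f: "\<And>i. i < N \<Longrightarrow> f i \<le> N" "\<And>i. i \<ge> N \<Longrightarrow> f i = i"
        and root: "\<And>i. i < N \<Longrightarrow> f i = N \<longleftrightarrow> i = r"
        by (auto simp: graph_rooted_maps_def rooted_maps_def)
      show "of_parents (to_parents f) i = f i"
      proof (cases "i < N \<and> i \<noteq> r")
        case True
        then have "f i < N" using f(1)[of i] root[of i] by simp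
        then show ?thesis using True r by (simp add: of_parents_def to_parents_def \<iota>\<nu> \<nu>V \<nu>_inj)
      next
        case False
        then show ?thesis using f(2)[of i] root[of i] r by (auto simp: of_parents_def)
      qed
    qed
    show "\<forall>g\<in>parent_maps V E (\<nu> r). to_parents (of_parents g) = g"
    proof (intro ballI ext)
      fix g v assume g: "g \<in> parent_maps V E (\<nu> r)"
      show "to_parents (of_parents g) v = g v"
      proof (cases "v \<in> V - {\<nu> r}")
        case True
        then have "g v \<in> V" using g by (auto simp: parent_maps_def)
        moreover have "\<iota> v \<noteq> r" using True \<iota>(2)[of v] by auto
        ultimately show ?thesis using True by (simp add: of_parents_def to_parents_def \<iota>)
      next
        case False
        have "g \<in> V - {\<nu> r} \<rightarrow>\<^sub>E V" using g by (simp add: parent_maps_def)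
        then have "g v = undefined" using False by (rule PiE_arb)
        then show ?thesis using False by (auto simp: to_parents_def)
      qed
    qed
    show "to_parents ` {f \<in> graph_rooted_maps N \<nu> E. {i. i < N \<and> f i = N} = {r}}
        \<subseteq> parent_maps V E (\<nu> r)"
    proof (rule image_subsetI)
      fix f assume "f \<in> {f \<in> graph_rooted_maps N \<nu> E. {i. i < N \<and> f i = N} = {r}}"
      then have f: "f \<in> graph_rooted_maps N \<nu> E" and root: "{i. i < N \<and> f i = N} = {r}"
        by simp_all
      have f_less: "f i < N" if "i < N" "i \<noteq> r" for i
      proof -
        have "f i \<le> N" using f that by (simp add: graph_rooted_maps_def rooted_maps_def)
        moreover have "f i \<noteq> N" using root that by blast
        ultimately show ?thesis by simp
      qed
      have edge: "{\<nu> i, \<nu> (f i)} \<in> E" if "i < N" "i \<noteq> r" for i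
        using f f_less[OF that] that by (simp add: graph_rooted_maps_def)
      obtain d :: "nat \<Rightarrow> nat" where d: "\<And>i. i < N \<Longrightarrow> f i < N \<Longrightarrow> d (f i) < d i"
        using f by (auto simp: graph_rooted_maps_def rooted_maps_def)
      have nonroot: "\<iota> v < N \<and> \<iota> v \<noteq> r" if "v \<in> V - {\<nu> r}" for v
        using \<iota>[of v] that by auto
      show "to_parents f \<in> parent_maps V E (\<nu> r)"
        unfolding parent_maps_def
      proof (intro CollectI conjI ballI)
        show "to_parents f \<in> (V - {\<nu> r}) \<rightarrow>\<^sub>E V"
          using nonroot f_less \<nu>V by (auto simp: to_parents_def)
        show "{v, to_parents f v} \<in> E" if "v \<in> V - {\<nu> r}" for v
          using edge[of "\<iota> v"] nonroot[OF that] that \<iota>(2)[of v] by (simp add: to_parents_def)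
        show "\<exists>d :: 'a \<Rightarrow> nat. \<forall>v\<in>V - {\<nu> r}. d (to_parents f v) < d v"
        proof (intro exI[of _ "d \<circ> \<iota>"] ballI)
          fix v assume v: "v \<in> V - {\<nu> r}"
          then show "(d \<circ> \<iota>) (to_parents f v) < (d \<circ> \<iota>) v"
            using d[of "\<iota> v"] f_less[of "\<iota> v"] nonroot[OF v] by (simp add: to_parents_def \<iota>\<nu>)
        qed
      qed
    qed
    show "of_parents ` parent_maps V E (\<nu> r)
        \<subseteq> {f \<in> graph_rooted_maps N \<nu> E. {i. i < N \<and> f i = N} = {r}}"
    proof (rule image_subsetI)
      fix g assume g: "g \<in> parent_maps V E (\<nu> r)"
      have gV: "g (\<nu> i) \<in> V" "{\<nu> i, g (\<nu> i)} \<in> E" if "i < N" "i \<noteq> r" for i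
        using g that \<nu>V[OF that(1)] \<nu>_inj[OF that(1) r] by (auto simp: parent_maps_def)
      obtain d :: "'a \<Rightarrow> nat" where d: "\<forall>v\<in>V - {\<nu> r}. d (g v) < d v"
        using g by (auto simp: parent_maps_def)
      have "d (\<nu> (of_parents g i)) < d (\<nu> i)" if "i < N" "of_parents g i < N" for i
      proof -
        have "i \<noteq> r" using that by (auto simp: of_parents_def)
        then show ?thesis
          using d that(1) \<nu>V[OF that(1)] \<nu>_inj[OF that(1) r] gV(1)[of i]
          by (simp add: of_parents_def \<iota>)
      qed
      then have "\<exists>d :: nat \<Rightarrow> nat. \<forall>i<N. of_parents g i < N \<longrightarrow> d (of_parents g i) < d i"
        by (intro exI[of _ "d \<circ> \<nu>"]) simp
      moreover have nonroot: "of_parents g i < N" "{\<nu> i, \<nu> (of_parents g i)} \<in> E"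
        if "i < N" "i \<noteq> r" for i
        using gV[OF that] \<iota>[OF gV(1)[OF that]] that by (simp_all add: of_parents_def)
      moreover have root: "of_parents g r = N" using r by (simp add: of_parents_def)
      ultimately have "of_parents g \<in> graph_rooted_maps N \<nu> E"
        unfolding graph_rooted_maps_def rooted_maps_def
        by (auto simp: of_parents_def[of g i for i] split: if_splits intro: less_imp_le)
      moreover have "{i. i < N \<and> of_parents g i = N} = {r}"
        using nonroot(1) root r by force
      ultimately show "of_parents g \<in> {f \<in> graph_rooted_maps N \<nu> E. {i. i < N \<and> f i = N} = {r}}"
        by simp
    qed
  qed
  then show ?thesis by (rule bij_betw_same_card)
qed

lemma card_graph_rooted_maps_single_root:
  assumes E: "simple_graph_on V E" and \<nu>: "bij_betw \<nu> {..<N} V"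
  shows "card {f \<in> graph_rooted_maps N \<nu> E. card {i. i < N \<and> f i = N} = 1} =
    N * card (spanning_trees V E)"
proof -
  define T where "T r = {f \<in> graph_rooted_maps N \<nu> E. {i. i < N \<and> f i = N} = {r}}" for r
  have "{f \<in> graph_rooted_maps N \<nu> E. card {i. i < N \<and> f i = N} = 1} = (\<Union>r<N. T r)"
    by (auto simp: T_def card_1_singleton_iff)
  moreover have "finite (T r)" for r
    by (rule finite_subset[OF _ finite_rooted_maps[of N]]) (auto simp: T_def graph_rooted_maps_def)
  moreover have "card (T r) = card (spanning_trees V E)" if "r < N" for r
  proof -
    have "\<nu> r \<in> V" using \<nu> that by (auto dest: bij_betwE)
    then show ?thesis
      using card_graph_rooted_maps_root[OF \<nu> that, of E]
        bij_betw_same_card[OF parent_maps_bij_spanning_trees[OF E]]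
      by (simp add: T_def)
  qed
  moreover have "T r \<inter> T r' = {}" if "r \<noteq> r'" for r r'
    using that by (auto simp: T_def)
  ultimately show ?thesis by (simp add: card_UN_disjoint)
qed

text \<open>
  The linear coefficient of \<open>det (x I + L)\<close> is described by continuity: away from \<open>x = 0\<close> the
  quotient of the determinant by \<open>x\<close> is the polynomial that counts rooted forests by the number of
  further roots, so its value at 0 is the number of trees with a distinguished root.  This form
  applies directly to a determinant known in factored form.
\<close>

theorem matrix_tree:
  fixes g :: "complex \<Rightarrow> complex"
  assumes E: "simple_graph_on V E" and \<nu>: "bij_betw \<nu> {..<N} V" and N: "0 < N"
    and det: "\<And>x. x \<noteq> 0 \<Longrightarrow>
      Determinant.det (laplacian_mat N (\<lambda>i k. of_bool ({\<nu> i, \<nu> k} \<in> E)) x) = x * g x"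
    and g: "isCont g 0"
  shows "of_nat (N * card (spanning_trees V E)) = g 0"
proof -
  let ?F = "graph_rooted_maps N \<nu> E"
  define roots where "roots f = card {i. i < N \<and> f i = N}" for f :: "nat \<Rightarrow> nat"
  define h :: "complex \<Rightarrow> complex" where "h x = (\<Sum>f\<in>?F. x ^ (roots f - 1))" for x
  have roots: "0 < roots f" if "f \<in> ?F" for f
    using exists_root[of f N] N that by (auto simp: roots_def card_gt_0_iff graph_rooted_maps_def)
  have fin: "finite ?F"
    by (rule finite_subset[OF _ finite_rooted_maps[of N]]) (auto simp: graph_rooted_maps_def)
  have "h x = g x" if x: "x \<noteq> 0" for x
  proof -
    have "x * g x = (\<Sum>f\<in>rooted_maps N. \<Prod>i<N. if f i = N then x else of_bool ({\<nu> i, \<nu> (f i)} \<in> E))"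
      using det[OF x] by (simp add: det_laplacian_mat)
    also have "\<dots> = (\<Sum>f\<in>?F. x ^ roots f)"
    proof (rule sum.mono_neutral_cong_right)
      show "\<forall>f\<in>rooted_maps N - ?F.
          (\<Prod>i<N. if f i = N then x else of_bool ({\<nu> i, \<nu> (f i)} \<in> E)) = 0"
      proof
        fix f assume "f \<in> rooted_maps N - ?F"
        then obtain i where "i < N" "f i < N" "{\<nu> i, \<nu> (f i)} \<notin> E"
          by (auto simp: graph_rooted_maps_def)
        then show "(\<Prod>i<N. if f i = N then x else of_bool ({\<nu> i, \<nu> (f i)} \<in> E)) = 0"
          by (intro prod_zero bexI[of _ i]) auto
      qed
      fix f assume f: "f \<in> ?F"
      have "(\<Prod>i<N. if f i = N then x else of_bool ({\<nu> i, \<nu> (f i)} \<in> E)) =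
          (\<Prod>i<N. if f i = N then x else 1)"
      proof (rule prod.cong)
        fix i assume "i \<in> {..<N}"
        then show "(if f i = N then x else of_bool ({\<nu> i, \<nu> (f i)} \<in> E)) =
            (if f i = N then x else 1)"
          using f by (force simp: graph_rooted_maps_def rooted_maps_def dest: le_neq_implies_less)
      qed simp
      also have "\<dots> = x ^ roots f"
        by (simp add: prod.If_cases roots_def Int_def conj_commute lessThan_def)
      finally show "(\<Prod>i<N. if f i = N then x else of_bool ({\<nu> i, \<nu> (f i)} \<in> E)) = x ^ roots f" .
    qed (auto simp: finite_rooted_maps graph_rooted_maps_def)
    also have "\<dots> = x * h x"
      unfolding h_def sum_distrib_left
      by (intro sum.cong refl) (metis Suc_diff_1 power_Suc roots)
    finally show ?thesis using x by simp
  qed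
  then have "\<forall>\<^sub>F x in at 0. h x = g x"
    by (auto simp: eventually_at_filter)
  moreover have "(h \<longlongrightarrow> h 0) (at 0)"
    unfolding h_def by (intro tendsto_intros)
  ultimately have "(g \<longlongrightarrow> h 0) (at 0)" by (rule Lim_transform_eventually[rotated])
  then have "g 0 = h 0"
    using g tendsto_unique[of "at (0 :: complex)" g "g 0" "h 0"] by (simp add: isCont_def)
  also have "\<dots> = (\<Sum>f\<in>?F. of_bool (roots f = 1))"
    unfolding h_def
  proof (intro sum.cong refl)
    fix f assume "f \<in> ?F"
    then show "0 ^ (roots f - 1) = (of_bool (roots f = 1) :: complex)"
      using roots[of f] by (cases "roots f - 1") auto
  qed
  also have "\<dots> = of_nat (card {f \<in> ?F. roots f = 1})"
    using fin by (simp add: of_bool_def sum.If_cases Int_def)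
  also have "\<dots> = of_nat (N * card (spanning_trees V E))"
    using card_graph_rooted_maps_single_root[OF E \<nu>] by (simp add: roots_def)
  finally show ?thesis by simp
qed

section \<open>Normal forms in the dihedral group\<close>

text \<open>
  Reading a word as an element \<open>b\<^sup>k a\<^sup>e\<close>, the two functions compute \<open>e\<close> and \<open>k\<close>.  Since \<open>a\<close> has order 2,
  its exponent sign is irrelevant, and moving \<open>a\<close> to the right past a power of \<open>b\<close> inverts that power.
\<close>

fun word_flip :: "dihedral_gen gword \<Rightarrow> bool" where
  "word_flip [] = False"
| "word_flip ((Gen_a, e) # w) = (\<not> word_flip w)"
| "word_flip ((Gen_b, e) # w) = word_flip w"

fun word_exp :: "dihedral_gen gword \<Rightarrow> int" where
  "word_exp [] = 0"
| "word_exp ((Gen_a, e) # w) = - word_exp w"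
| "word_exp ((Gen_b, e) # w) = (if e then - 1 else 1) + word_exp w"

lemma word_flip_append: "word_flip (u @ v) \<longleftrightarrow> word_flip u \<noteq> word_flip v"
  by (induction u rule: word_flip.induct) auto

lemma word_exp_append:
  "word_exp (u @ v) = word_exp u + (if word_flip u then - word_exp v else word_exp v)"
  by (induction u rule: word_exp.induct) auto

lemma word_exp_replicate [simp]:
  "word_exp (replicate k (Gen_b, e)) = (if e then - int k else int k)"
  by (induction k) auto

lemma word_flip_replicate [simp]: "\<not> word_flip (replicate k (Gen_b, e))"
  by (induction k) auto

text \<open>
  These invariants keep the \<open>2 n\<close> normal forms apart: they provide a homomorphism onto a concrete
  dihedral group without constructing that group.
\<close>

lemma dihedral_pres_eq_invariants:
  assumes "pres_eq (dihedral_relators n) u v"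
  shows "word_flip u = word_flip v \<and> int n dvd word_exp u - word_exp v"
  using assms
proof induction
  case (pres_sym u v)
  then show ?case by (metis dvd_diff_commute)
next
  case (pres_trans u v w)
  then show ?case by (metis diff_add_cancel dvd_add add_diff_eq)
next
  case (pres_append u u' v v')
  have "word_exp (u @ v) - word_exp (u' @ v') = (word_exp u - word_exp u') +
      (if word_flip u then - (word_exp v - word_exp v') else word_exp v - word_exp v')"
    using pres_append.IH by (simp add: word_exp_append)
  then show ?case using pres_append.IH by (auto simp: word_flip_append simp del: minus_diff_eq)
next
  case (pres_cancel x e)
  then show ?case by (cases x; cases e) auto
next
  case (pres_relator r)
  then show ?case by (auto simp: dihedral_relators_def)
qed simp

definition dih_word :: "int \<Rightarrow> bool \<Rightarrow> dihedral_gen gword" where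
  "dih_word k e = replicate (nat \<bar>k\<bar>) (Gen_b, k < 0) @ (if e then [(Gen_a, False)] else [])"

definition dih_elt :: "nat \<Rightarrow> int \<Rightarrow> bool \<Rightarrow> dihedral_gen gword set" where
  "dih_elt n k e = pres_class (dihedral_relators n) (dih_word k e)"

lemma word_exp_dih_word [simp]: "word_exp (dih_word k e) = k"
  by (auto simp: dih_word_def word_exp_append)

lemma word_flip_dih_word [simp]: "word_flip (dih_word k e) = e"
  by (auto simp: dih_word_def word_flip_append)

lemma group_dihedral: "group (dihedral n)"
  by (simp add: dihedral_def group_presented_group)

context
  fixes n :: nat
begin

interpretation D: group "dihedral n" by (rule group_dihedral)

private abbreviation "cls \<equiv> pres_class (dihedral_relators n)"

lemma class_carrier: "cls w \<in> carrier (dihedral n)"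
  by (simp add: dihedral_def carrier_presented_group)

lemma class_append: "cls (u @ v) = cls u \<otimes>\<^bsub>dihedral n\<^esub> cls v"
  by (simp add: dihedral_def mult_presented_group)

lemma class_Nil: "cls [] = \<one>\<^bsub>dihedral n\<^esub>"
  by (simp add: dihedral_def one_presented_group)

lemma dih_carrier: "dih_a n \<in> carrier (dihedral n)" "dih_b n \<in> carrier (dihedral n)"
  by (simp_all add: dih_a_def dih_b_def class_carrier)

lemma class_relator: "r \<in> dihedral_relators n \<Longrightarrow> cls r = \<one>\<^bsub>dihedral n\<^esub>"
  using pres_relator by (simp add: class_Nil[symmetric] pres_class_eq_iff)

lemma class_letter_inverse: "cls [(x, True)] = inv\<^bsub>dihedral n\<^esub> cls [(x, False)]"
proof (rule D.inv_equality[symmetric])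
  have "cls [(x, True)] \<otimes>\<^bsub>dihedral n\<^esub> cls [(x, False)] = cls [(x, True), (x, \<not> True)]"
    by (simp flip: class_append)
  also have "\<dots> = \<one>\<^bsub>dihedral n\<^esub>"
    by (simp only: class_Nil[symmetric] pres_class_eq_iff pres_cancel)
  finally show "cls [(x, True)] \<otimes>\<^bsub>dihedral n\<^esub> cls [(x, False)] = \<one>\<^bsub>dihedral n\<^esub>" .
qed (rule class_carrier)+

lemma a_square: "dih_a n \<otimes>\<^bsub>dihedral n\<^esub> dih_a n = \<one>\<^bsub>dihedral n\<^esub>"
proof -
  have "[(Gen_a, False)] @ [(Gen_a, False)] \<in> dihedral_relators n"
    by (simp add: dihedral_relators_def)
  from class_relator[OF this] show ?thesis by (simp only: class_append dih_a_def)
qed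

lemma class_replicate: "cls (replicate k (x, False)) = cls [(x, False)] [^]\<^bsub>dihedral n\<^esub> k"
proof (induction k)
  case (Suc k)
  have "cls (replicate (Suc k) (x, False)) = cls (replicate k (x, False) @ [(x, False)])"
    by (simp add: replicate_append_same)
  then show ?case using Suc by (simp only: class_append D.nat_pow_Suc)
qed (simp add: class_Nil)

lemma b_pow_n: "dih_b n [^]\<^bsub>dihedral n\<^esub> n = \<one>\<^bsub>dihedral n\<^esub>"
  unfolding dih_b_def class_replicate[symmetric]
  by (rule class_relator) (simp add: dihedral_relators_def)

lemma a_b_swap: "dih_a n \<otimes>\<^bsub>dihedral n\<^esub> dih_b n = inv\<^bsub>dihedral n\<^esub> dih_b n \<otimes>\<^bsub>dihedral n\<^esub> dih_a n"
proof -
  let ?ab = "dih_a n \<otimes>\<^bsub>dihedral n\<^esub> dih_b n"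
  have "[(Gen_a, False)] @ [(Gen_b, False)] @ [(Gen_a, False)] @ [(Gen_b, False)]
      \<in> dihedral_relators n"
    by (simp add: dihedral_relators_def)
  from class_relator[OF this] have "?ab \<otimes>\<^bsub>dihedral n\<^esub> ?ab = \<one>\<^bsub>dihedral n\<^esub>"
    by (simp only: class_append dih_a_def dih_b_def D.m_assoc class_carrier D.m_closed)
  then have "?ab = inv\<^bsub>dihedral n\<^esub> ?ab"
    using dih_carrier by (simp add: D.inv_equality)
  also have "\<dots> = inv\<^bsub>dihedral n\<^esub> dih_b n \<otimes>\<^bsub>dihedral n\<^esub> inv\<^bsub>dihedral n\<^esub> dih_a n"
    using dih_carrier by (simp add: D.inv_mult_group)
  also have "inv\<^bsub>dihedral n\<^esub> dih_a n = dih_a n"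
    using dih_carrier a_square by (simp add: D.inv_equality)
  finally show ?thesis .
qed

lemma a_b_pow_swap:
  "dih_a n \<otimes>\<^bsub>dihedral n\<^esub> (dih_b n [^]\<^bsub>dihedral n\<^esub> (k :: int)) =
   (dih_b n [^]\<^bsub>dihedral n\<^esub> (- k)) \<otimes>\<^bsub>dihedral n\<^esub> dih_a n"
proof -
  let ?a = "dih_a n" and ?b = "dih_b n"
  have nat: "?a \<otimes>\<^bsub>dihedral n\<^esub> (?b [^]\<^bsub>dihedral n\<^esub> m) =
      (inv\<^bsub>dihedral n\<^esub> ?b [^]\<^bsub>dihedral n\<^esub> m) \<otimes>\<^bsub>dihedral n\<^esub> ?a" for m :: nat
  proof (induction m)
    case (Suc m)
    have "?a \<otimes>\<^bsub>dihedral n\<^esub> (?b [^]\<^bsub>dihedral n\<^esub> Suc m) =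
        (?a \<otimes>\<^bsub>dihedral n\<^esub> (?b [^]\<^bsub>dihedral n\<^esub> m)) \<otimes>\<^bsub>dihedral n\<^esub> ?b"
      using dih_carrier by (simp add: D.m_assoc)
    also have "\<dots> = (inv\<^bsub>dihedral n\<^esub> ?b [^]\<^bsub>dihedral n\<^esub> m) \<otimes>\<^bsub>dihedral n\<^esub> (?a \<otimes>\<^bsub>dihedral n\<^esub> ?b)"
      unfolding Suc using dih_carrier by (simp add: D.m_assoc)
    also have "\<dots> = (inv\<^bsub>dihedral n\<^esub> ?b [^]\<^bsub>dihedral n\<^esub> Suc m) \<otimes>\<^bsub>dihedral n\<^esub> ?a"
      unfolding a_b_swap using dih_carrier by (simp add: D.m_assoc)
    finally show ?case .
  qed (use dih_carrier in simp)
  have swap: "?a \<otimes>\<^bsub>dihedral n\<^esub> (?b [^]\<^bsub>dihedral n\<^esub> int m) =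
      (?b [^]\<^bsub>dihedral n\<^esub> (- int m)) \<otimes>\<^bsub>dihedral n\<^esub> ?a" for m
    using nat[of m] dih_carrier by (simp add: D.int_pow_neg_int D.nat_pow_inv int_pow_int)
  show ?thesis
  proof (cases k rule: int_cases2)
    case (nonneg m)
    then show ?thesis using swap by simp
  next
    case (nonpos m)
    \<comment> \<open>For a negative exponent, the identity for its absolute value is multiplied by the inverse
      power from both sides.\<close>
    let ?p = "?b [^]\<^bsub>dihedral n\<^esub> int m" and ?q = "?b [^]\<^bsub>dihedral n\<^esub> (- int m)"
    have inverse: "?p \<otimes>\<^bsub>dihedral n\<^esub> ?q = \<one>\<^bsub>dihedral n\<^esub>" "?q \<otimes>\<^bsub>dihedral n\<^esub> ?p = \<one>\<^bsub>dihedral n\<^esub>"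
      using dih_carrier D.int_pow_mult[of ?b "int m" "- int m"] D.int_pow_mult[of ?b "- int m" "int m"]
      by simp_all
    have pq: "?p \<in> carrier (dihedral n)" "?q \<in> carrier (dihedral n)"
      using dih_carrier by simp_all
    have "?a \<otimes>\<^bsub>dihedral n\<^esub> ?q = (?p \<otimes>\<^bsub>dihedral n\<^esub> ?q) \<otimes>\<^bsub>dihedral n\<^esub> ?a \<otimes>\<^bsub>dihedral n\<^esub> ?q"
      using dih_carrier pq by (simp add: inverse)
    also have "\<dots> = ?p \<otimes>\<^bsub>dihedral n\<^esub> (?q \<otimes>\<^bsub>dihedral n\<^esub> ?a) \<otimes>\<^bsub>dihedral n\<^esub> ?q"
      using dih_carrier pq by (simp add: D.m_assoc)
    also have "\<dots> = ?p \<otimes>\<^bsub>dihedral n\<^esub> ?a \<otimes>\<^bsub>dihedral n\<^esub> (?p \<otimes>\<^bsub>dihedral n\<^esub> ?q)"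
      unfolding swap[symmetric]
      using dih_carrier pq by (simp add: D.m_assoc)
    also have "\<dots> = ?p \<otimes>\<^bsub>dihedral n\<^esub> ?a" using dih_carrier pq by (simp add: inverse)
    finally show ?thesis using nonpos by simp
  qed
qed

text \<open>
  The defining relations allow every word to be brought into the form \<open>b\<^sup>k a\<^sup>e\<close>.
\<close>

lemma class_normal_form:
  "cls w = (dih_b n [^]\<^bsub>dihedral n\<^esub> word_exp w) \<otimes>\<^bsub>dihedral n\<^esub>
     (if word_flip w then dih_a n else \<one>\<^bsub>dihedral n\<^esub>)"
proof (induction w)
  case Nil
  show ?case by (simp add: class_Nil)
next
  case (Cons l w)
  obtain x e where l: "l = (x, e)" by force
  let ?A = "if word_flip w then dih_a n else \<one>\<^bsub>dihedral n\<^esub>"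
  have A: "?A \<in> carrier (dihedral n)" using dih_carrier by simp
  have Cons': "cls (l # w) = cls [l] \<otimes>\<^bsub>dihedral n\<^esub> ((dih_b n [^]\<^bsub>dihedral n\<^esub> word_exp w) \<otimes>\<^bsub>dihedral n\<^esub> ?A)"
    using class_append[of "[l]" w] Cons.IH by simp
  show ?case
  proof (cases x)
    case Gen_a
    have "inv\<^bsub>dihedral n\<^esub> dih_a n = dih_a n"
      using dih_carrier a_square by (simp add: D.inv_equality)
    then have "cls [l] = dih_a n"
      using class_letter_inverse[of Gen_a] by (cases e) (auto simp: l Gen_a dih_a_def)
    then have "cls (l # w) = (dih_a n \<otimes>\<^bsub>dihedral n\<^esub> (dih_b n [^]\<^bsub>dihedral n\<^esub> word_exp w)) \<otimes>\<^bsub>dihedral n\<^esub> ?A"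
      using dih_carrier A by (simp add: Cons' D.m_assoc)
    also have "\<dots> = (dih_b n [^]\<^bsub>dihedral n\<^esub> (- word_exp w)) \<otimes>\<^bsub>dihedral n\<^esub> (dih_a n \<otimes>\<^bsub>dihedral n\<^esub> ?A)"
      unfolding a_b_pow_swap using dih_carrier A by (simp add: D.m_assoc)
    also have "dih_a n \<otimes>\<^bsub>dihedral n\<^esub> ?A = (if word_flip (l # w) then dih_a n else \<one>\<^bsub>dihedral n\<^esub>)"
      using dih_carrier a_square by (simp add: l Gen_a)
    finally show ?thesis by (simp add: l Gen_a)
  next
    case Gen_b
    have "cls [l] = dih_b n [^]\<^bsub>dihedral n\<^esub> (if e then - 1 else 1 :: int)"
      using class_letter_inverse[of Gen_b] dih_carrier
      by (auto simp: l Gen_b dih_b_def[symmetric] D.int_pow_neg)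
    then have "cls (l # w) = (dih_b n [^]\<^bsub>dihedral n\<^esub> (if e then - 1 else 1 :: int)
        \<otimes>\<^bsub>dihedral n\<^esub> (dih_b n [^]\<^bsub>dihedral n\<^esub> word_exp w)) \<otimes>\<^bsub>dihedral n\<^esub> ?A"
      unfolding Cons' using dih_carrier A by (simp add: D.m_assoc)
    also have "\<dots> = dih_b n [^]\<^bsub>dihedral n\<^esub> ((if e then - 1 else 1) + word_exp w) \<otimes>\<^bsub>dihedral n\<^esub> ?A"
      using D.int_pow_mult[OF dih_carrier(2)] by simp
    finally show ?thesis by (simp add: l Gen_b)
  qed
qed

lemma class_eq_dih_elt: "cls w = dih_elt n (word_exp w) (word_flip w)"
  unfolding dih_elt_def class_normal_form[of w] class_normal_form[of "dih_word _ _"] by simp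

lemma carrier_dihedral: "carrier (dihedral n) = {dih_elt n k e | k e. True}"
  unfolding dihedral_def carrier_presented_group
  using class_eq_dih_elt by (auto simp: dih_elt_def)

lemma dih_elt_eq_iff: "dih_elt n k e = dih_elt n l f \<longleftrightarrow> e = f \<and> int n dvd k - l"
proof
  assume "dih_elt n k e = dih_elt n l f"
  then have "pres_eq (dihedral_relators n) (dih_word k e) (dih_word l f)"
    by (simp add: dih_elt_def pres_class_eq_iff)
  from dihedral_pres_eq_invariants[OF this] show "e = f \<and> int n dvd k - l" by simp
next
  assume "e = f \<and> int n dvd k - l"
  then obtain m where m: "k = l + int n * m" and "e = f" by (metis diff_add_cancel dvdE add.commute)
  have "dih_b n [^]\<^bsub>dihedral n\<^esub> k = dih_b n [^]\<^bsub>dihedral n\<^esub> l \<otimes>\<^bsub>dihedral n\<^esub> dih_b n [^]\<^bsub>dihedral n\<^esub> (int n * m)"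
    unfolding m by (rule D.int_pow_mult[OF dih_carrier(2)])
  also have "dih_b n [^]\<^bsub>dihedral n\<^esub> (int n * m) = \<one>\<^bsub>dihedral n\<^esub>"
    using D.int_pow_pow[OF dih_carrier(2), of "int n" m] b_pow_n by (simp add: int_pow_int)
  finally have "dih_b n [^]\<^bsub>dihedral n\<^esub> k = dih_b n [^]\<^bsub>dihedral n\<^esub> l"
    using dih_carrier by simp
  then show "dih_elt n k e = dih_elt n l f"
    using \<open>e = f\<close> class_normal_form[of "dih_word k e"] class_normal_form[of "dih_word l f"]
    by (simp add: dih_elt_def)
qed

lemma dih_elt_mult:
  "dih_elt n k e \<otimes>\<^bsub>dihedral n\<^esub> dih_elt n l f = dih_elt n (k + (if e then - l else l)) (e \<noteq> f)"
proof -
  have "dih_elt n k e \<otimes>\<^bsub>dihedral n\<^esub> dih_elt n l f = cls (dih_word k e @ dih_word l f)"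
    by (simp add: dih_elt_def class_append)
  then show ?thesis by (simp add: class_eq_dih_elt word_exp_append word_flip_append)
qed

lemma b_pow_eq_dih_elt: "dih_b n [^]\<^bsub>dihedral n\<^esub> k = dih_elt n k False"
  using class_normal_form[of "dih_word k False"] dih_carrier by (simp add: dih_elt_def)

lemma a_eq_dih_elt: "dih_a n = dih_elt n 0 True"
  by (simp add: dih_a_def dih_elt_def dih_word_def)

end

section \<open>The Cayley graph in terms of normal forms\<close>

lemma connection_set_eq:
  "dihedral_connection_set n s t \<beta> \<gamma> =
     {dih_elt n x False | x. x \<in> \<beta> ` {1..s} \<union> (\<lambda>i. - \<beta> i) ` {1..s}} \<union>
     {dih_elt n (- y) True | y. y \<in> \<gamma> ` {1..t}}"
  unfolding dihedral_connection_set_def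
  by (auto simp: b_pow_eq_dih_elt a_eq_dih_elt dih_elt_mult)

text \<open>
  Adjacency of \<open>b\<^sup>k a\<^sup>e\<close> and \<open>b\<^sup>l a\<^sup>f\<close>, where \<open>X\<close> is the symmetric set of all exponents of \<open>b\<close> and \<open>Y\<close> the
  set of all \<open>\<gamma>\<close> in the connection set.  As \<open>a b\<^sup>\<gamma> = b\<^sup>-\<^sup>\<gamma> a\<close>, the shift by \<open>\<gamma>\<close> changes its sign
  with the side from which the edge is looked at.
\<close>

definition dih_adj :: "nat \<Rightarrow> int set \<Rightarrow> int set \<Rightarrow> int \<Rightarrow> bool \<Rightarrow> int \<Rightarrow> bool \<Rightarrow> bool" where
  "dih_adj n X Y k e l f \<longleftrightarrow>
     (if e = f then \<exists>x\<in>X. int n dvd l - k - x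
      else if e then \<exists>y\<in>Y. int n dvd l - k - y else \<exists>y\<in>Y. int n dvd l - k + y)"

lemma dih_adj_sym:
  assumes X: "uminus ` X = X" and "dih_adj n X Y k e l f"
  shows "dih_adj n X Y l f k e"
proof (cases "e = f")
  case True
  then obtain x where "x \<in> X" "int n dvd l - k - x" using assms by (auto simp: dih_adj_def)
  then have "- x \<in> X" "int n dvd k - l - (- x)" using X
    by (auto simp: algebra_simps dest: dvd_minus_iff[THEN iffD2])
  then have "\<exists>x\<in>X. int n dvd k - l - x" by blast
  then show ?thesis using True by (simp add: dih_adj_def)
next
  case False
  have *: "int n dvd k - l + y \<longleftrightarrow> int n dvd l - k - y" for y
    using dvd_minus_iff[of "int n" "l - k - y"] by (simp add: algebra_simps)
  have **: "int n dvd k - l - y \<longleftrightarrow> int n dvd l - k + y" for y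
    using dvd_minus_iff[of "int n" "l - k + y"] by (simp add: algebra_simps)
  show ?thesis using False assms(2) by (auto simp: dih_adj_def * ** split: if_splits)
qed

text \<open>
  An edge is an unordered pair, so either end point may be the one that is multiplied by an element
  of the connection set; the symmetry of \<open>X\<close> makes both conditions equivalent.
\<close>

lemma dihedral_edge_iff:
  fixes X Y :: "int set"
  assumes X: "uminus ` X = X"
    and S: "S = {dih_elt n x False | x. x \<in> X} \<union> {dih_elt n (- y) True | y. y \<in> Y}"
  shows "{dih_elt n k e, dih_elt n l f} \<in> cayley_edges (dihedral n) S \<longleftrightarrow> dih_adj n X Y k e l f"
proof -
  have step: "(\<exists>x\<in>S. dih_elt n l f = dih_elt n k e \<otimes>\<^bsub>dihedral n\<^esub> x) \<longleftrightarrow> dih_adj n X Y k e l f"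
    for k e l f
  proof -
    have "(\<exists>x\<in>S. dih_elt n l f = dih_elt n k e \<otimes>\<^bsub>dihedral n\<^esub> x) \<longleftrightarrow>
        (\<exists>x\<in>X. dih_elt n l f = dih_elt n k e \<otimes>\<^bsub>dihedral n\<^esub> dih_elt n x False) \<or>
        (\<exists>y\<in>Y. dih_elt n l f = dih_elt n k e \<otimes>\<^bsub>dihedral n\<^esub> dih_elt n (- y) True)"
      unfolding S by blast
    also have "\<dots> \<longleftrightarrow> (\<exists>x\<in>X. f = e \<and> int n dvd l - (k + (if e then - x else x))) \<or>
        (\<exists>y\<in>Y. f = (\<not> e) \<and> int n dvd l - (k + (if e then y else - y)))"
      by (simp add: dih_elt_mult dih_elt_eq_iff)
    also have "(\<exists>x\<in>X. f = e \<and> int n dvd l - (k + (if e then - x else x))) \<longleftrightarrow>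
        f = e \<and> (\<exists>x\<in>X. int n dvd l - k - x)"
    proof (cases e)
      case True
      have "(\<exists>x\<in>X. int n dvd l - k - x) \<longleftrightarrow> (\<exists>x\<in>uminus ` X. int n dvd l - k - x)"
        by (simp only: X)
      then show ?thesis using True by (simp add: diff_diff_eq)
    qed (simp add: diff_diff_eq)
    finally show ?thesis by (auto simp: dih_adj_def algebra_simps)
  qed
  have carrier: "dih_elt n k e \<in> carrier (dihedral n)" for k e
    by (auto simp: carrier_dihedral)
  have "{dih_elt n k e, dih_elt n l f} \<in> cayley_edges (dihedral n) S \<longleftrightarrow>
      (\<exists>x\<in>S. dih_elt n l f = dih_elt n k e \<otimes>\<^bsub>dihedral n\<^esub> x) \<or>
      (\<exists>x\<in>S. dih_elt n k e = dih_elt n l f \<otimes>\<^bsub>dihedral n\<^esub> x)"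
    using carrier[of k e] carrier[of l f] by (auto simp: cayley_edges_def doubleton_eq_iff)
  then show ?thesis unfolding step using dih_adj_sym[OF X] by blast
qed

lemma dihedral_cayley_simple:
  fixes X Y :: "int set"
  assumes X: "uminus ` X = X" "\<And>x. x \<in> X \<Longrightarrow> \<not> int n dvd x"
    and S: "S = {dih_elt n x False | x. x \<in> X} \<union> {dih_elt n (- y) True | y. y \<in> Y}"
  shows "simple_graph_on (carrier (dihedral n)) (cayley_edges (dihedral n) S)"
  unfolding simple_graph_on_def
proof
  fix E assume E: "E \<in> cayley_edges (dihedral n) S"
  then obtain u v where uv: "E = {u, v}" "u \<in> carrier (dihedral n)" "v \<in> carrier (dihedral n)"
    by (auto simp: cayley_edges_def)
  then obtain k e l f where kl: "u = dih_elt n k e" "v = dih_elt n l f"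
    by (auto simp: carrier_dihedral)
  have "dih_adj n X Y k e l f" using E dihedral_edge_iff[OF X(1) S] by (simp add: uv kl)
  have "u \<noteq> v"
  proof
    assume "u = v"
    then have ef: "e = f" and kl_dvd: "int n dvd l - k"
      by (simp_all add: kl dih_elt_eq_iff dvd_diff_commute)
    obtain x where "x \<in> X" "int n dvd l - k - x"
      using \<open>dih_adj n X Y k e l f\<close> ef by (auto simp: dih_adj_def)
    then show False using X(2) dvd_diff[OF kl_dvd, of "l - k - x"] by simp
  qed
  then show "\<exists>u\<in>carrier (dihedral n). \<exists>v\<in>carrier (dihedral n). u \<noteq> v \<and> E = {u, v}"
    using uv by blast
qed

definition dih_vertex :: "nat \<Rightarrow> nat \<Rightarrow> dihedral_gen gword set" where
  "dih_vertex n i = (if i < n then dih_elt n (int i) False else dih_elt n (int (i - n)) True)"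

lemma bij_betw_dih_vertex:
  assumes n: "0 < n"
  shows "bij_betw (dih_vertex n) {..<n + n} (carrier (dihedral n))"
proof (rule bij_betw_imageI)
  have eq: "i = j" if "i < n" "j < n" "int n dvd int i - int j" for i j
    using that by (metis mod_eq_dvd_iff mod_less of_nat_eq_iff zmod_int)
  show "inj_on (dih_vertex n) {..<n + n}"
  proof (rule inj_onI)
    fix i j assume ij: "i \<in> {..<n + n}" "j \<in> {..<n + n}" "dih_vertex n i = dih_vertex n j"
    then have same_side: "i < n \<longleftrightarrow> j < n"
      by (simp add: dih_vertex_def dih_elt_eq_iff split: if_splits)
    show "i = j"
    proof (cases "i < n")
      case True
      then have "int n dvd int i - int j"
        using ij(3) same_side by (simp add: dih_vertex_def dih_elt_eq_iff)
      then show ?thesis using True same_side by (intro eq) simp_all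
    next
      case False
      then have "int n dvd int (i - n) - int (j - n)"
        using ij(3) same_side by (simp add: dih_vertex_def dih_elt_eq_iff del: of_nat_diff)
      then have "i - n = j - n" using ij(1,2) by (intro eq) auto
      then show ?thesis using False same_side by simp
    qed
  qed
  show "dih_vertex n ` {..<n + n} = carrier (dihedral n)"
  proof
    show "dih_vertex n ` {..<n + n} \<subseteq> carrier (dihedral n)"
      by (auto simp: dih_vertex_def carrier_dihedral)
    show "carrier (dihedral n) \<subseteq> dih_vertex n ` {..<n + n}"
    proof
      fix u assume "u \<in> carrier (dihedral n)"
      then obtain k e where u: "u = dih_elt n k e" by (auto simp: carrier_dihedral)
      define i where "i = nat (k mod int n)"
      have i: "i < n" "int i = k mod int n" using n by (auto simp: i_def nat_less_iff)
      have "dih_elt n k e = dih_elt n (int i) e"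
        by (simp add: dih_elt_eq_iff i(2) minus_mod_eq_mult_div)
      then have "u = dih_vertex n (if e then n + i else i)"
        using i(1) by (simp add: u dih_vertex_def)
      moreover have "(if e then n + i else i) \<in> {..<n + n}" using i(1) by simp
      ultimately show "u \<in> dih_vertex n ` {..<n + n}" by blast
    qed
  qed
qed

section \<open>Circulant blocks and the discrete Fourier transform\<close>

text \<open>
  The adjacency matrix of the Cayley digraph of the integers modulo \<open>n\<close> with connection set \<open>X\<close>.
\<close>

definition circulant :: "nat \<Rightarrow> int set \<Rightarrow> complex mat" where
  "circulant n X = Matrix.mat n n (\<lambda>(i, k). of_bool (\<exists>x\<in>X. int n dvd int k - int i - x))"

definition unity_root :: "nat \<Rightarrow> complex" where
  "unity_root n = cis (2 * pi / n)"

definition fourier_mat :: "nat \<Rightarrow> complex mat" where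
  "fourier_mat n = Matrix.mat n n (\<lambda>(k, j). (unity_root n ^ j) ^ k)"

lemma unity_root_nonzero [simp]: "unity_root n \<noteq> 0"
  by (simp add: unity_root_def)

lemma unity_root_pow_n: "0 < n \<Longrightarrow> (unity_root n ^ j) ^ n = 1"
proof -
  assume n: "0 < n"
  have "unity_root n ^ n = 1"
    using n by (simp add: unity_root_def Complex.DeMoivre)
  then show ?thesis by (metis power_commutes power_mult mult.commute power_one)
qed

lemma unity_root_inj:
  assumes "i < n" "j < n" "unity_root n ^ i = unity_root n ^ j"
  shows "i = j"
proof -
  have "inj_on (\<lambda>k. cis (2 * pi * real k / real n)) {..<n}"
    using Complex.bij_betw_roots_unity[of n] assms(1) by (simp add: bij_betw_def)
  moreover have "unity_root n ^ k = cis (2 * pi * real k / real n)" for k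
    by (simp add: unity_root_def Complex.DeMoivre mult_ac)
  ultimately show ?thesis using assms by (auto dest: inj_onD)
qed

lemma power_int_cong_mod:
  fixes z :: complex
  assumes "z ^ n = 1" "0 < n" "int n dvd a - b"
  shows "z powi a = z powi b"
proof -
  have z: "z \<noteq> 0" using assms by (auto simp: power_0_left)
  obtain m where "a = b + int n * m" using assms(3) by (metis add_diff_cancel_left' diff_add_cancel dvdE add.commute)
  then have "z powi a = z powi b * (z ^ n) powi m"
    using z by (simp add: power_int_add power_int_mult)
  then show ?thesis using assms(1) by simp
qed

text \<open>
  The vector of powers of an \<open>n\<close>-th root of unity is an eigenvector of each circulant matrix.  The
  elements of \<open>X\<close> must be incongruent modulo \<open>n\<close>, as otherwise the matrix would count them only once.
\<close>

lemma circulant_row_sum: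
  fixes z :: complex
  assumes X: "finite X" "\<And>x y. x \<in> X \<Longrightarrow> y \<in> X \<Longrightarrow> int n dvd x - y \<Longrightarrow> x = y"
    and n: "0 < n" and z: "z ^ n = 1"
  shows "(\<Sum>k<n. of_bool (\<exists>x\<in>X. int n dvd int k - int i - x) * z ^ k) = z ^ i * (\<Sum>x\<in>X. z powi x)"
proof -
  have z0: "z \<noteq> 0" using z n by (auto simp: power_0_left)
  have indicator: "of_bool (\<exists>x\<in>X. int n dvd int k - int i - x) =
      (\<Sum>x\<in>X. of_bool (int n dvd int k - int i - x) :: complex)" for k
  proof (cases "\<exists>x\<in>X. int n dvd int k - int i - x")
    case True
    then obtain x where x: "x \<in> X" "int n dvd int k - int i - x" by blast
    have "of_bool (int n dvd int k - int i - y) = (if y = x then 1 else 0 :: complex)"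
      if "y \<in> X" for y
    proof (cases "y = x")
      case False
      then have "\<not> int n dvd y - x" using X(2)[OF that x(1)] by blast
      then have "\<not> int n dvd int k - int i - y"
        using dvd_diff[OF x(2), of "int k - int i - y"] by auto
      then show ?thesis using False by simp
    qed (simp add: x(2))
    then have "(\<Sum>y\<in>X. of_bool (int n dvd int k - int i - y) :: complex) =
        (\<Sum>y\<in>X. if y = x then 1 else 0)"
      by (intro sum.cong refl)
    then show ?thesis using True x(1) X(1) by simp
  next
    case False
    then show ?thesis by simp
  qed
  have one: "(\<Sum>k<n. of_bool (int n dvd int k - int i - x) * z ^ k) = z ^ i * z powi x" for x
  proof -
    define m where "m = nat ((int i + x) mod int n)"
    have m: "m < n" "int m = (int i + x) mod int n" using n by (auto simp: m_def nat_less_iff)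
    have "int n dvd int k - int i - x \<longleftrightarrow> k = m" if "k < n" for k
    proof -
      have "int n dvd int k - int i - x \<longleftrightarrow> int k mod int n = (int i + x) mod int n"
        by (simp add: mod_eq_dvd_iff diff_diff_eq)
      also have "\<dots> \<longleftrightarrow> k = m" using that by (simp add: m(2)[symmetric])
      finally show ?thesis .
    qed
    then have "(\<Sum>k<n. of_bool (int n dvd int k - int i - x) * z ^ k) = (\<Sum>k<n. if k = m then z ^ m else 0)"
      by (intro sum.cong) auto
    also have "\<dots> = z powi (int m)" using m(1) by simp
    also have "\<dots> = z powi (int i + x)"
      using z n by (rule power_int_cong_mod) (simp add: m(2) mod_eq_dvd_iff[symmetric])
    also have "\<dots> = z ^ i * z powi x" using z0 by (simp add: power_int_add)
    finally show ?thesis .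
  qed
  have "(\<Sum>k<n. of_bool (\<exists>x\<in>X. int n dvd int k - int i - x) * z ^ k) =
      (\<Sum>k<n. \<Sum>x\<in>X. of_bool (int n dvd int k - int i - x) * z ^ k)"
    by (simp add: indicator sum_distrib_right)
  also have "\<dots> = (\<Sum>x\<in>X. \<Sum>k<n. of_bool (int n dvd int k - int i - x) * z ^ k)"
    by (rule sum.swap)
  also have "\<dots> = z ^ i * (\<Sum>x\<in>X. z powi x)"
    by (simp add: one sum_distrib_left)
  finally show ?thesis .
qed

lemma fourier_mat_carrier [simp]: "fourier_mat n \<in> carrier_mat n n"
  by (simp add: fourier_mat_def)

lemma circulant_carrier [simp]: "circulant n X \<in> carrier_mat n n"
  by (simp add: circulant_def)

lemma circulant_fourier:
  assumes "finite X" "\<And>x y. x \<in> X \<Longrightarrow> y \<in> X \<Longrightarrow> int n dvd x - y \<Longrightarrow> x = y"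
  shows "circulant n X * fourier_mat n =
    fourier_mat n * mat_diag n (\<lambda>j. \<Sum>x\<in>X. (unity_root n ^ j) powi x)"
proof (rule eq_matI)
  fix i j
  assume "i < dim_row (fourier_mat n * mat_diag n (\<lambda>j. \<Sum>x\<in>X. (unity_root n ^ j) powi x))"
    and "j < dim_col (fourier_mat n * mat_diag n (\<lambda>j. \<Sum>x\<in>X. (unity_root n ^ j) powi x))"
  then have ij: "i < n" "j < n" by (simp_all add: fourier_mat_def mat_diag_def)
  let ?z = "unity_root n ^ j"
  have "(circulant n X * fourier_mat n) $$ (i, j) =
      (\<Sum>k<n. of_bool (\<exists>x\<in>X. int n dvd int k - int i - x) * ?z ^ k)"
    using ij by (simp add: circulant_def fourier_mat_def scalar_prod_def lessThan_atLeast0)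
  also have "\<dots> = ?z ^ i * (\<Sum>x\<in>X. ?z powi x)"
    using ij by (intro circulant_row_sum assms unity_root_pow_n) auto
  also have "\<dots> = (fourier_mat n * mat_diag n (\<lambda>j. \<Sum>x\<in>X. (unity_root n ^ j) powi x)) $$ (i, j)"
    using ij by (subst mat_diag_mult_right[of _ n]) (simp_all add: fourier_mat_def)
  finally show "(circulant n X * fourier_mat n) $$ (i, j) =
      (fourier_mat n * mat_diag n (\<lambda>j. \<Sum>x\<in>X. (unity_root n ^ j) powi x)) $$ (i, j)" .
qed (simp_all add: circulant_def fourier_mat_def mat_diag_def)

lemma det_mat_diag: "Determinant.det (mat_diag n f) = (\<Prod>j<n. f j)"
proof -
  have "Determinant.det (mat_diag n f) = prod_list (diag_mat (mat_diag n f))"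
    by (rule det_lower_triangular[of n]) (auto simp: mat_diag_def)
  also have "diag_mat (mat_diag n f) = map f [0..<n]"
    by (auto simp: diag_mat_def mat_diag_def)
  also have "prod_list (map f [0..<n]) = (\<Prod>j<n. f j)"
    by (simp add: prod.distinct_set_conv_list[symmetric] lessThan_atLeast0)
  finally show ?thesis .
qed

text \<open>
  By orthogonality of the characters, the matrix of inverse powers is \<open>n\<close> times the inverse.
\<close>

lemma det_fourier_mat_nonzero: "Determinant.det (fourier_mat n) \<noteq> 0"
proof -
  define G where "G = Matrix.mat n n (\<lambda>(j, k). inverse (unity_root n ^ j) ^ k)"
  have G: "G \<in> carrier_mat n n" by (simp add: G_def)
  have "G * fourier_mat n = mat_diag n (\<lambda>j. of_nat n)"
  proof (rule eq_matI)
    fix i j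
    assume "i < dim_row (mat_diag n (\<lambda>j. of_nat n :: complex))"
      and "j < dim_col (mat_diag n (\<lambda>j. of_nat n :: complex))"
    then have ij: "i < n" "j < n" by (simp_all add: mat_diag_def)
    define q where "q = unity_root n ^ j / unity_root n ^ i"
    have "(G * fourier_mat n) $$ (i, j) = (\<Sum>k<n. q ^ k)"
      using ij by (simp add: G_def fourier_mat_def scalar_prod_def lessThan_atLeast0 q_def
          divide_inverse mult.commute power_mult_distrib power_inverse)
    also have "\<dots> = (if i = j then of_nat n else 0)"
    proof (cases "i = j")
      case False
      have "q \<noteq> 1" using False unity_root_inj[OF ij(2,1)] by (auto simp: q_def)
      moreover have "q ^ n = 1" using ij by (simp add: q_def power_divide unity_root_pow_n)
      ultimately show ?thesis using False by (simp add: sum_gp_strict)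
    qed (simp add: q_def)
    finally show "(G * fourier_mat n) $$ (i, j) = mat_diag n (\<lambda>j. of_nat n) $$ (i, j)"
      using ij by (simp add: mat_diag_def)
  qed (simp_all add: G_def fourier_mat_def mat_diag_def)
  then have "Determinant.det G * Determinant.det (fourier_mat n) = (\<Prod>j<n. of_nat n)"
    using det_mult[OF G fourier_mat_carrier] by (simp add: det_mat_diag)
  also have "\<dots> \<noteq> 0" by auto
  finally show ?thesis by auto
qed

text \<open>
  Conjugation by the block diagonal matrix with two blocks \<open>F\<close> turns all four blocks into diagonal
  matrices.  These commute, so the determinant reduces to that of the matrix \<open>a d - b c\<close>.
\<close>

lemma det_block_simultaneously_diagonal:
  fixes A B C D F :: "complex mat"
  assumes carrier: "A \<in> carrier_mat n n" "B \<in> carrier_mat n n" "C \<in> carrier_mat n n"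
      "D \<in> carrier_mat n n" "F \<in> carrier_mat n n"
    and F: "Determinant.det F \<noteq> 0"
    and diag: "A * F = F * mat_diag n a" "B * F = F * mat_diag n b"
      "C * F = F * mat_diag n c" "D * F = F * mat_diag n d"
  shows "Determinant.det (four_block_mat A B C D) = (\<Prod>j<n. a j * d j - b j * c j)"
proof -
  let ?Z = "0\<^sub>m n n :: complex mat"
  let ?FF = "four_block_mat F ?Z ?Z F"
  let ?DD = "four_block_mat (mat_diag n a) (mat_diag n b) (mat_diag n c) (mat_diag n d)"
  have "four_block_mat A B C D * ?FF = ?FF * ?DD"
    using carrier
    by (simp add: mult_four_block_mat[where ?nr1.0 = n and ?n1.0 = n and ?n2.0 = n and ?nr2.0 = n
          and ?nc1.0 = n and ?nc2.0 = n] diag left_mult_zero_mat[where nc = n]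
          left_add_zero_mat[where nr = n and nc = n] right_add_zero_mat[where nr = n and nc = n])
  moreover have "Determinant.det (four_block_mat A B C D * ?FF) =
      Determinant.det (four_block_mat A B C D) * Determinant.det ?FF"
    using carrier by (intro det_mult[of _ "n + n"]) auto
  moreover have "Determinant.det (?FF * ?DD) = Determinant.det ?FF * Determinant.det ?DD"
    using carrier by (intro det_mult[of _ "n + n"]) auto
  moreover have "Determinant.det ?FF = Determinant.det F * Determinant.det F"
    using carrier by (intro det_four_block_mat_upper_right_zero) auto
  moreover have "Determinant.det ?DD = (\<Prod>j<n. a j * d j - b j * c j)"
  proof -
    have "mat_diag n a * mat_diag n d - mat_diag n b * mat_diag n c =
        mat_diag n (\<lambda>j. a j * d j - b j * c j)"
      unfolding mat_diag_diag by (rule eq_matI) (auto simp: mat_diag_def)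
    moreover have "Determinant.det ?DD =
        Determinant.det (mat_diag n a * mat_diag n d - mat_diag n b * mat_diag n c)"
      by (rule det_four_block_mat[of _ n]) (simp_all add: mult.commute)
    ultimately show ?thesis by (simp add: det_mat_diag)
  qed
  ultimately show ?thesis using F by simp
qed

lemma shifted_circulant_fourier:
  assumes "finite X" "\<And>x y. x \<in> X \<Longrightarrow> y \<in> X \<Longrightarrow> int n dvd x - y \<Longrightarrow> x = y"
  shows "(mat_diag n (\<lambda>_. a) - circulant n X) * fourier_mat n =
    fourier_mat n * mat_diag n (\<lambda>j. a - (\<Sum>x\<in>X. (unity_root n ^ j) powi x))"
proof -
  let ?f = "\<lambda>j. \<Sum>x\<in>X. (unity_root n ^ j) powi x"
  have "(mat_diag n (\<lambda>_. a) - circulant n X) * fourier_mat n =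
      mat_diag n (\<lambda>_. a) * fourier_mat n - circulant n X * fourier_mat n"
    by (rule minus_mult_distrib_mat[of _ n n _ _ n]) auto
  also have "mat_diag n (\<lambda>_. a) * fourier_mat n = fourier_mat n * mat_diag n (\<lambda>_. a)"
    unfolding mat_diag_mult_left[OF fourier_mat_carrier] mat_diag_mult_right[OF fourier_mat_carrier]
    by (rule eq_matI) auto
  also have "circulant n X * fourier_mat n = fourier_mat n * mat_diag n ?f"
    using assms by (rule circulant_fourier)
  also have "fourier_mat n * mat_diag n (\<lambda>_. a) - fourier_mat n * mat_diag n ?f =
      fourier_mat n * (mat_diag n (\<lambda>_. a) - mat_diag n ?f)"
    by (rule mult_minus_distrib_mat[symmetric, of _ n n _ n]) auto
  also have "mat_diag n (\<lambda>_. a) - mat_diag n ?f = mat_diag n (\<lambda>j. a - ?f j)"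
    by (rule eq_matI) (auto simp: mat_diag_def)
  finally show ?thesis .
qed

lemma sum_lessThan_add:
  fixes f :: "nat \<Rightarrow> 'a :: comm_monoid_add"
  shows "(\<Sum>k<n + m. f k) = (\<Sum>k<n. f k) + (\<Sum>k<m. f (n + k))"
  by (induction m) (simp_all add: add.assoc)

text \<open>
  The indices below \<open>n\<close> stand for the powers \<open>b\<^sup>i\<close>, those from \<open>n\<close> on for the elements \<open>b\<^sup>i a\<close>.  The two
  diagonal blocks are the same circulant; the off-diagonal ones are the negatives of the adjacency
  circulants for \<open>-Y\<close> and \<open>Y\<close>.
\<close>

theorem dihedral_laplacian_det:
  fixes X Y :: "int set"
  assumes n: "0 < n"
    and X: "finite X" "uminus ` X = X" "\<And>x y. x \<in> X \<Longrightarrow> y \<in> X \<Longrightarrow> int n dvd x - y \<Longrightarrow> x = y"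
      "\<And>x. x \<in> X \<Longrightarrow> \<not> int n dvd x"
    and Y: "finite Y" "\<And>x y. x \<in> Y \<Longrightarrow> y \<in> Y \<Longrightarrow> int n dvd x - y \<Longrightarrow> x = y"
    and S: "S = {dih_elt n x False | x. x \<in> X} \<union> {dih_elt n (- y) True | y. y \<in> Y}"
  shows "Determinant.det (laplacian_mat (n + n)
      (\<lambda>i k. of_bool ({dih_vertex n i, dih_vertex n k} \<in> cayley_edges (dihedral n) S)) x) =
    (\<Prod>j<n. (x + of_nat (card X + card Y) - (\<Sum>m\<in>X. (unity_root n ^ j) powi m))\<^sup>2 -
       (\<Sum>m\<in>Y. (unity_root n ^ j) powi (- m)) * (\<Sum>m\<in>Y. (unity_root n ^ j) powi m))"
proof -
  let ?w = "\<lambda>i k. of_bool ({dih_vertex n i, dih_vertex n k} \<in> cayley_edges (dihedral n) S) :: complex"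
  define Y' where "Y' = uminus ` Y"
  have Y': "finite Y'" "\<And>x y. x \<in> Y' \<Longrightarrow> y \<in> Y' \<Longrightarrow> int n dvd x - y \<Longrightarrow> x = y"
    using Y by (auto simp: Y'_def dvd_diff_commute)
  define d :: complex where "d = x + of_nat (card X + card Y)"
  let ?A = "mat_diag n (\<lambda>_. d) - circulant n X"
  let ?B = "mat_diag n (\<lambda>_. 0) - circulant n Y'"
  let ?C = "mat_diag n (\<lambda>_. 0) - circulant n Y"
  have edge: "?w i k = of_bool (dih_adj n X Y (int (if i < n then i else i - n)) (\<not> i < n)
      (int (if k < n then k else k - n)) (\<not> k < n))" for i k
    using dihedral_edge_iff[OF X(2) S] by (simp add: dih_vertex_def)
  have count: "(\<Sum>k<n. of_bool (\<exists>x\<in>Z. int n dvd int k - int i - x)) = (of_nat (card Z) :: complex)"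
    if "finite Z" "\<And>x y. x \<in> Z \<Longrightarrow> y \<in> Z \<Longrightarrow> int n dvd x - y \<Longrightarrow> x = y" for Z i
    using circulant_row_sum[OF that n, of 1 i] by simp
  have split: "(\<Sum>k<n + n. ?w i k) = (\<Sum>k<n. ?w i k) + (\<Sum>k<n. ?w i (n + k))" for i
    by (rule sum_lessThan_add)
  have w_blocks:
    "i < n \<Longrightarrow> k < n \<Longrightarrow> ?w i k = of_bool (\<exists>x\<in>X. int n dvd int k - int i - x)"
    "i < n \<Longrightarrow> ?w i (n + k) = of_bool (\<exists>x\<in>Y'. int n dvd int k - int i - x)"
    "k < n \<Longrightarrow> ?w (n + i) k = of_bool (\<exists>x\<in>Y. int n dvd int k - int i - x)"
    "?w (n + i) (n + k) = of_bool (\<exists>x\<in>X. int n dvd int k - int i - x)" for i k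
    unfolding edge by (simp_all add: dih_adj_def Y'_def)
  have card_Y': "card Y' = card Y" by (simp add: Y'_def card_image)
  have degree: "(\<Sum>k<n + n. ?w i k) = of_nat (card X + card Y)" if i: "i < n + n" for i
  proof (cases "i < n")
    case True
    then show ?thesis
      unfolding split using count[OF X(1,3)] count[OF Y'] by (simp add: w_blocks card_Y')
  next
    case False
    then obtain i' where "i = n + i'" by (metis le_add_diff_inverse not_less)
    then show ?thesis
      unfolding split using count[OF X(1,3)] count[OF Y] by (simp add: w_blocks)
  qed
  have "laplacian_mat (n + n) ?w x = four_block_mat ?A ?B ?C ?A"
  proof (rule eq_matI)
    fix i k assume "i < dim_row (four_block_mat ?A ?B ?C ?A)" "k < dim_col (four_block_mat ?A ?B ?C ?A)"
    then have ik: "i < n + n" "k < n + n" by (simp_all add: circulant_def)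
    have lap: "laplacian_mat (n + n) ?w x $$ (i, k) = of_bool (i = k) * d - ?w i k"
      using ik degree[OF ik(1)] by (simp add: laplacian_mat_def d_def)
    consider "i < n" "k < n" | k' where "i < n" "k = n + k'" "k' < n"
      | i' where "i = n + i'" "i' < n" "k < n" | i' k' where "i = n + i'" "i' < n" "k = n + k'" "k' < n"
      using ik by (metis add_less_cancel_left le_add_diff_inverse not_less)
    then show "laplacian_mat (n + n) ?w x $$ (i, k) = four_block_mat ?A ?B ?C ?A $$ (i, k)"
      unfolding lap by cases (simp_all add: w_blocks circulant_def mat_diag_def)
  qed (simp_all add: laplacian_mat_def circulant_def)
  also have "Determinant.det \<dots> = (\<Prod>j<n.
      (d - (\<Sum>m\<in>X. (unity_root n ^ j) powi m)) * (d - (\<Sum>m\<in>X. (unity_root n ^ j) powi m)) -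
      (0 - (\<Sum>m\<in>Y'. (unity_root n ^ j) powi m)) * (0 - (\<Sum>m\<in>Y. (unity_root n ^ j) powi m)))"
    by (rule det_block_simultaneously_diagonal[where F = "fourier_mat n"])
      (simp_all add: shifted_circulant_fourier X Y Y' det_fourier_mat_nonzero minus_carrier_mat)
  also have "(\<lambda>j. \<Sum>m\<in>Y'. (unity_root n ^ j) powi m) = (\<lambda>j. \<Sum>m\<in>Y. (unity_root n ^ j) powi (- m))"
    by (simp add: Y'_def sum.reindex)
  finally show ?thesis by (simp add: d_def power2_eq_square Y'_def sum.reindex)
qed

text \<open>
  At the trivial root of unity the factor of the determinant is
  \<open>(x + t)\<^sup>2 - t\<^sup>2 = x (x + 2 t)\<close> with \<open>t = card Y\<close>; it carries the zero at \<open>x = 0\<close> that the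
  matrix-tree theorem divides out.
\<close>

theorem dihedral_spanning_trees_product:
  fixes X Y :: "int set"
  assumes n: "0 < n"
    and X: "finite X" "uminus ` X = X" "\<And>x y. x \<in> X \<Longrightarrow> y \<in> X \<Longrightarrow> int n dvd x - y \<Longrightarrow> x = y"
      "\<And>x. x \<in> X \<Longrightarrow> \<not> int n dvd x"
    and Y: "finite Y" "\<And>x y. x \<in> Y \<Longrightarrow> y \<in> Y \<Longrightarrow> int n dvd x - y \<Longrightarrow> x = y"
    and S: "S = {dih_elt n x False | x. x \<in> X} \<union> {dih_elt n (- y) True | y. y \<in> Y}"
  shows "of_nat (n * card (spanning_trees (carrier (dihedral n)) (cayley_edges (dihedral n) S))) =
    of_nat (card Y) * (\<Prod>j\<in>{1..<n}.
      (of_nat (card X + card Y) - (\<Sum>m\<in>X. (unity_root n ^ j) powi m))\<^sup>2 -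
       (\<Sum>m\<in>Y. (unity_root n ^ j) powi (- m)) * (\<Sum>m\<in>Y. (unity_root n ^ j) powi m))"
proof -
  define p where "p x j = (x + of_nat (card X + card Y) - (\<Sum>m\<in>X. (unity_root n ^ j) powi m))\<^sup>2 -
       (\<Sum>m\<in>Y. (unity_root n ^ j) powi (- m)) * (\<Sum>m\<in>Y. (unity_root n ^ j) powi m)" for x j
  have p0: "p x 0 = x * (x + 2 * of_nat (card Y))" for x
    by (simp add: p_def power2_eq_square algebra_simps)
  have "{..<n} = insert 0 {1..<n}" using n by auto
  then have prod: "(\<Prod>j<n. p x j) = x * ((x + 2 * of_nat (card Y)) * (\<Prod>j\<in>{1..<n}. p x j))" for x
    by (simp add: p0 mult.assoc)
  have "of_nat ((n + n) * card (spanning_trees (carrier (dihedral n)) (cayley_edges (dihedral n) S))) =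
      (\<lambda>x. (x + 2 * of_nat (card Y)) * (\<Prod>j\<in>{1..<n}. p x j)) 0"
  proof (rule matrix_tree)
    show "simple_graph_on (carrier (dihedral n)) (cayley_edges (dihedral n) S)"
      using dihedral_cayley_simple[OF X(2,4) S] .
    show "bij_betw (dih_vertex n) {..<n + n} (carrier (dihedral n))"
      using n by (rule bij_betw_dih_vertex)
    show "isCont (\<lambda>x. (x + 2 * of_nat (card Y)) * (\<Prod>j\<in>{1..<n}. p x j)) 0"
      unfolding p_def by (intro continuous_intros)
    show "Determinant.det (laplacian_mat (n + n)
        (\<lambda>i k. of_bool ({dih_vertex n i, dih_vertex n k} \<in> cayley_edges (dihedral n) S)) x) =
        x * ((x + 2 * of_nat (card Y)) * (\<Prod>j\<in>{1..<n}. p x j))" for x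
      unfolding prod[symmetric] unfolding p_def using assms by (rule dihedral_laplacian_det)
  qed (use n in simp)
  then show ?thesis by (simp add: p_def algebra_simps)
qed

section \<open>Linear functionals on Laurent polynomials\<close>

text \<open>
  The linear functional with value \<open>\<phi> k\<close> at \<open>z\<^sup>k\<close>.  Evaluation at a point, extraction of a
  coefficient and the moments of the coefficients are all of this form, so that one formula for the
  values on products (\<open>laurent_sum_mult\<close>) handles them together.
\<close>

definition laurent_sum :: "(int \<Rightarrow> complex) \<Rightarrow> laurent_poly \<Rightarrow> complex" where
  "laurent_sum \<phi> f = (\<Sum>k\<in>Poly_Mapping.keys f. Poly_Mapping.lookup f k * \<phi> k)"

lemma laurent_sum_superset:
  assumes "finite K" "Poly_Mapping.keys f \<subseteq> K"
  shows "laurent_sum \<phi> f = (\<Sum>k\<in>K. Poly_Mapping.lookup f k * \<phi> k)"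
  unfolding laurent_sum_def
  using assms by (intro sum.mono_neutral_left) (auto simp: in_keys_iff)

lemma laurent_sum_add: "laurent_sum \<phi> (f + g) = laurent_sum \<phi> f + laurent_sum \<phi> g"
proof -
  let ?K = "Poly_Mapping.keys f \<union> Poly_Mapping.keys g"
  have "laurent_sum \<phi> (f + g) = (\<Sum>k\<in>?K. Poly_Mapping.lookup (f + g) k * \<phi> k)"
    by (intro laurent_sum_superset keys_add) simp
  also have "\<dots> = (\<Sum>k\<in>?K. Poly_Mapping.lookup f k * \<phi> k) + (\<Sum>k\<in>?K. Poly_Mapping.lookup g k * \<phi> k)"
    by (simp add: lookup_add distrib_right sum.distrib)
  also have "\<dots> = laurent_sum \<phi> f + laurent_sum \<phi> g"
    by (intro arg_cong2[where f = "(+)"] laurent_sum_superset[symmetric]) auto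
  finally show ?thesis .
qed

lemma laurent_sum_zero [simp]: "laurent_sum \<phi> 0 = 0"
  by (simp add: laurent_sum_def)

lemma laurent_sum_uminus: "laurent_sum \<phi> (- f) = - laurent_sum \<phi> f"
  using laurent_sum_add[of \<phi> f "- f"] by (simp add: eq_neg_iff_add_eq_0 add.commute)

lemma laurent_sum_diff: "laurent_sum \<phi> (f - g) = laurent_sum \<phi> f - laurent_sum \<phi> g"
  using laurent_sum_add[of \<phi> f "- g"] by (simp add: laurent_sum_uminus)

lemma laurent_sum_sum: "laurent_sum \<phi> (\<Sum>i\<in>I. f i) = (\<Sum>i\<in>I. laurent_sum \<phi> (f i))"
  by (induction I rule: infinite_finite_induct) (simp_all add: laurent_sum_add)

lemma laurent_sum_single [simp]: "laurent_sum \<phi> (Poly_Mapping.single k c) = c * \<phi> k"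
  by (cases "c = 0") (simp_all add: laurent_sum_def)

lemma laurent_sum_of_nat: "laurent_sum \<phi> (of_nat m) = of_nat m * \<phi> 0"
  by (simp flip: single_of_nat)

lemma laurent_sum_lookup: "laurent_sum (\<lambda>k. of_bool (k = m)) f = Poly_Mapping.lookup f m"
proof -
  have "laurent_sum (\<lambda>k. of_bool (k = m)) f =
      (\<Sum>k\<in>insert m (Poly_Mapping.keys f). if k = m then Poly_Mapping.lookup f k else 0)"
    by (subst laurent_sum_superset[of "insert m (Poly_Mapping.keys f)"])
      (auto intro!: sum.cong)
  then show ?thesis by simp
qed

lemma laurent_expansion:
  "f = (\<Sum>k\<in>Poly_Mapping.keys f. Poly_Mapping.single k (Poly_Mapping.lookup f k))"
proof (rule poly_mapping_eqI)
  fix m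
  have "(\<Sum>k\<in>Poly_Mapping.keys f. Poly_Mapping.lookup (Poly_Mapping.single k (Poly_Mapping.lookup f k)) m) =
      (\<Sum>k\<in>Poly_Mapping.keys f. if k = m then Poly_Mapping.lookup f m else 0)"
    by (intro sum.cong) (auto simp: lookup_single when_def)
  then show "Poly_Mapping.lookup f m =
      Poly_Mapping.lookup (\<Sum>k\<in>Poly_Mapping.keys f. Poly_Mapping.single k (Poly_Mapping.lookup f k)) m"
    by (auto simp: lookup_sum in_keys_iff)
qed

lemma laurent_sum_mult:
  "laurent_sum \<phi> (f * g) = (\<Sum>k\<in>Poly_Mapping.keys f. \<Sum>l\<in>Poly_Mapping.keys g.
     Poly_Mapping.lookup f k * Poly_Mapping.lookup g l * \<phi> (k + l))"
proof -
  have "f * g = (\<Sum>k\<in>Poly_Mapping.keys f. \<Sum>l\<in>Poly_Mapping.keys g.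
      Poly_Mapping.single (k + l) (Poly_Mapping.lookup f k * Poly_Mapping.lookup g l))"
    by (subst (1) laurent_expansion[of f], subst (1) laurent_expansion[of g])
      (simp only: sum_product mult_single)
  then show ?thesis by (simp only: laurent_sum_sum laurent_sum_single)
qed

lemma lookup_laurent_inv: "Poly_Mapping.lookup (laurent_inv f) k = Poly_Mapping.lookup f (- k)"
  by (simp add: laurent_inv_def map_key.rep_eq inj_def)

lemma keys_laurent_inv: "Poly_Mapping.keys (laurent_inv f) = uminus ` Poly_Mapping.keys f"
proof (rule Set.set_eqI)
  fix k
  have "k \<in> uminus ` Poly_Mapping.keys f \<longleftrightarrow> - k \<in> Poly_Mapping.keys f"
    by (metis image_iff minus_minus)
  then show "k \<in> Poly_Mapping.keys (laurent_inv f) \<longleftrightarrow> k \<in> uminus ` Poly_Mapping.keys f"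
    by (simp add: in_keys_iff lookup_laurent_inv)
qed

lemma laurent_sum_inv: "laurent_sum \<phi> (laurent_inv f) = laurent_sum (\<lambda>k. \<phi> (- k)) f"
  by (simp add: laurent_sum_def keys_laurent_inv sum.reindex lookup_laurent_inv)

lemma laurent_sum_mult_inv:
  "laurent_sum \<phi> (f * laurent_inv f) = (\<Sum>k\<in>Poly_Mapping.keys f. \<Sum>l\<in>Poly_Mapping.keys f.
     Poly_Mapping.lookup f k * Poly_Mapping.lookup f l * \<phi> (k - l))"
  by (simp add: laurent_sum_mult keys_laurent_inv sum.reindex lookup_laurent_inv)

text \<open>
  The coefficient at \<open>m\<close> is the sum of the \<open>f\<^sub>k f\<^sub>l\<close> with \<open>k - l = m\<close>, which is symmetric in \<open>k\<close> and \<open>l\<close>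
  up to the sign of \<open>m\<close>.
\<close>

lemma lookup_mult_inv_sym:
  "Poly_Mapping.lookup (f * laurent_inv f) (- m) = Poly_Mapping.lookup (f * laurent_inv f) m"
proof -
  have flip: "of_bool (k - l = - m) = (of_bool (l - k = m) :: complex)" for k l :: int
    by auto
  show ?thesis
    unfolding laurent_sum_lookup[symmetric] laurent_sum_mult_inv flip
    by (subst sum.swap) (simp add: mult.commute)
qed

lemma laurent_sum_power_mult:
  assumes "z \<noteq> 0"
  shows "laurent_sum (\<lambda>k. z powi k) (f * g) = laurent_sum (\<lambda>k. z powi k) f * laurent_sum (\<lambda>k. z powi k) g"
  unfolding laurent_sum_mult laurent_sum_def[of _ f] laurent_sum_def[of _ g] sum_product
  using assms by (intro sum.cong refl) (simp add: power_int_add mult_ac)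

text \<open>
  This is \<open>(k - l)\<^sup>2 = k\<^sup>2 + l\<^sup>2 - 2 k l\<close>, weighted by \<open>f\<^sub>k f\<^sub>l\<close> and summed.
\<close>

lemma laurent_second_moment_mult_inv:
  "laurent_sum (\<lambda>k. of_int k ^ 2) (f * laurent_inv f) =
     2 * laurent_sum (\<lambda>k. of_int k ^ 2) f * laurent_sum (\<lambda>_. 1) f -
     2 * (laurent_sum of_int f)\<^sup>2"
proof -
  let ?c = "Poly_Mapping.lookup f" and ?K = "Poly_Mapping.keys f"
  have "laurent_sum (\<lambda>k. of_int k ^ 2) (f * laurent_inv f) =
      (\<Sum>k\<in>?K. \<Sum>l\<in>?K. (?c k * of_int k ^ 2) * ?c l + ?c k * (?c l * of_int l ^ 2) -
        2 * ((?c k * of_int k) * (?c l * of_int l)))"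
    unfolding laurent_sum_mult_inv by (intro sum.cong refl) (simp add: power2_eq_square algebra_simps)
  also have "\<dots> = (\<Sum>k\<in>?K. ?c k * of_int k ^ 2) * (\<Sum>l\<in>?K. ?c l) +
      (\<Sum>k\<in>?K. ?c k) * (\<Sum>l\<in>?K. ?c l * of_int l ^ 2) -
      2 * ((\<Sum>k\<in>?K. ?c k * of_int k) * (\<Sum>l\<in>?K. ?c l * of_int l))"
    by (simp only: sum.distrib sum_subtractf sum_product sum_distrib_left[where r = 2])
  finally show ?thesis by (simp add: laurent_sum_def power2_eq_square algebra_simps)
qed

section \<open>Chebyshev polynomials and the roots of the Chebyshev transform\<close>

lemma chebyshev_T_0: "chebyshev_T 0 = 1"
  by (simp add: poly_eq_poly_eq_iff[symmetric] fun_eq_iff poly_chebyshev_T)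

lemma chebyshev_T_1: "chebyshev_T (Suc 0) = [:0, 1:]"
  by (simp add: poly_eq_poly_eq_iff[symmetric] fun_eq_iff poly_chebyshev_T)

lemma chebyshev_T_Suc_Suc:
  "chebyshev_T (Suc (Suc k)) = [:0, 2:] * chebyshev_T (Suc k) - chebyshev_T k"
proof (rule poly_eq_poly_eq_iff[THEN iffD1], rule ext)
  fix x
  let ?y = "of_nat (Suc k) * Arccos x"
  have "of_nat (Suc (Suc k)) * Arccos x = ?y + Arccos x" "of_nat k * Arccos x = ?y - Arccos x"
    by (simp_all add: algebra_simps)
  then have "cos (of_nat (Suc (Suc k)) * Arccos x) = 2 * x * cos ?y - cos (of_nat k * Arccos x)"
    by (simp only: cos_add cos_diff cos_Arccos) (simp add: algebra_simps)
  then show "poly (chebyshev_T (Suc (Suc k))) x =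
      poly ([:0, 2:] * chebyshev_T (Suc k) - chebyshev_T k) x"
    by (simp only: poly_diff poly_mult poly_chebyshev_T) simp
qed

lemma chebyshev_induct [case_names 0 1 step]:
  assumes "P 0" "P (Suc 0)" "\<And>k. P k \<Longrightarrow> P (Suc k) \<Longrightarrow> P (Suc (Suc k))"
  shows "P (k :: nat)"
  using assms by (rule induct_nat_012)

text \<open>
  For \<open>z = e\<^sup>i\<^sup>\<theta>\<close> this says that \<open>T(k, cos \<theta>) = cos (k \<theta>)\<close>; the three-term recurrence proves it for
  all complex \<open>z \<noteq> 0\<close>.
\<close>

lemma chebyshev_T_joukowski:
  assumes "z \<noteq> 0"
  shows "2 * poly (chebyshev_T k) ((z + inverse z) / 2) = z ^ k + inverse z ^ k"
proof (induction k rule: chebyshev_induct)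
  case (step k)
  let ?w = "(z + inverse z) / 2"
  have "2 * poly (chebyshev_T (Suc (Suc k))) ?w =
      (z + inverse z) * (2 * poly (chebyshev_T (Suc k)) ?w) - 2 * poly (chebyshev_T k) ?w"
    by (simp add: chebyshev_T_Suc_Suc algebra_simps)
  also have "\<dots> = z ^ Suc (Suc k) + inverse z ^ Suc (Suc k)"
    unfolding step using assms by (simp add: field_simps)
  finally show ?case .
qed (simp_all add: chebyshev_T_0 chebyshev_T_1)

lemma chebyshev_T_at_1: "poly (chebyshev_T k) 1 = 1"
  using chebyshev_T_joukowski[of 1 k] by simp

lemma chebyshev_T_deriv_at_1: "poly (pderiv (chebyshev_T k)) 1 = of_nat k ^ 2"
proof (induction k rule: chebyshev_induct)
  case (step k)
  then show ?case
    by (simp add: chebyshev_T_Suc_Suc pderiv_diff pderiv_mult pderiv_smult pderiv_pCons chebyshev_T_at_1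
        power2_eq_square algebra_simps)
qed (simp_all add: chebyshev_T_0 chebyshev_T_1 pderiv_pCons)

lemma chebyshev_T_degree: "degree (chebyshev_T k) \<le> k"
proof (induction k rule: chebyshev_induct)
  case (step k)
  have "degree ([:0, 2:] * chebyshev_T (Suc k)) \<le> Suc (Suc k)"
    by (rule order.trans[OF degree_mult_le]) (use step(2) in simp)
  then show ?case
    unfolding chebyshev_T_Suc_Suc using step(1) by (intro degree_diff_le) auto
qed (simp_all add: chebyshev_T_0 chebyshev_T_1)

lemma chebyshev_T_coeff: "Polynomial.coeff (chebyshev_T (Suc k)) (Suc k) = 2 ^ k"
proof (induction k)
  case (Suc k)
  have "Polynomial.coeff (chebyshev_T k) (Suc (Suc k)) = 0"
    using chebyshev_T_degree[of k] by (intro coeff_eq_0) simp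
  then show ?case using Suc by (simp add: chebyshev_T_Suc_Suc)
qed (simp add: chebyshev_T_1)

text \<open>
  The conditions say that \<open>f\<close> is invariant under \<open>z \<mapsto> 1/z\<close> and vanishes at \<open>z = 1\<close>, but only to
  second order.  They are what is needed for 1 to be a simple root of the Chebyshev transform.
\<close>

locale symmetric_laurent =
  fixes f :: laurent_poly
  assumes sym: "Poly_Mapping.lookup f (- k) = Poly_Mapping.lookup f k"
    and moment_0: "laurent_sum (\<lambda>_. 1) f = 0"
    and moment_2: "laurent_sum (\<lambda>k. of_int k ^ 2) f \<noteq> 0"
begin

definition "r = nat (laurent_top f)"
definition "Q = chebyshev_transform f"

lemma top_exponent: "laurent_top f = int r" "0 < r" "Poly_Mapping.lookup f (int r) \<noteq> 0"
  "k \<in> Poly_Mapping.keys f \<Longrightarrow> \<bar>k\<bar> \<le> int r"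
proof -
  \<comment> \<open>A constant has second moment zero.\<close>
  have "\<exists>k\<in>Poly_Mapping.keys f. k \<noteq> 0"
  proof (rule ccontr)
    assume "\<not> (\<exists>k\<in>Poly_Mapping.keys f. k \<noteq> 0)"
    then have "laurent_sum (\<lambda>k. of_int k ^ 2) f = 0"
      unfolding laurent_sum_def by (intro sum.neutral) auto
    then show False using moment_2 by simp
  qed
  then obtain k0 where k0: "k0 \<in> Poly_Mapping.keys f" "k0 \<noteq> 0" by blast
  have abs_le: "\<bar>k\<bar> \<le> laurent_top f" if "k \<in> Poly_Mapping.keys f" for k
  proof -
    have "\<bar>k\<bar> \<in> Poly_Mapping.keys f" using that sym[of k] by (auto simp: in_keys_iff abs_if)
    then show ?thesis by (simp add: laurent_top_def)
  qed
  have pos: "0 < laurent_top f" using abs_le[OF k0(1)] k0(2) by simp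
  then show r: "laurent_top f = int r" and "0 < r" by (simp_all add: r_def)
  have "laurent_top f \<in> Poly_Mapping.keys f"
    unfolding laurent_top_def using k0(1) by (intro Max_in) auto
  then show "Poly_Mapping.lookup f (int r) \<noteq> 0" by (simp add: r in_keys_iff)
  show "k \<in> Poly_Mapping.keys f \<Longrightarrow> \<bar>k\<bar> \<le> int r" using abs_le r by simp
qed

lemma laurent_sum_symmetric:
  "laurent_sum \<phi> f = Poly_Mapping.lookup f 0 * \<phi> 0 +
     (\<Sum>k = 1..r. Poly_Mapping.lookup f (int k) * (\<phi> (int k) + \<phi> (- int k)))"
proof -
  let ?K = "insert 0 (int ` {1..r} \<union> (\<lambda>k. - int k) ` {1..r})"
  have "Poly_Mapping.keys f \<subseteq> ?K"
  proof
    fix k assume "k \<in> Poly_Mapping.keys f"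
    then have "\<bar>k\<bar> \<le> int r" by (rule top_exponent)
    then consider "k = 0" | "0 < k" "k = int (nat k)" "nat k \<in> {1..r}"
      | "k < 0" "k = - int (nat (- k))" "nat (- k) \<in> {1..r}"
      by (cases k "0 :: int" rule: linorder_cases)
        (auto simp: Suc_le_eq nat_le_iff)
    then show "k \<in> ?K" by cases blast+
  qed
  then have "laurent_sum \<phi> f = (\<Sum>k\<in>?K. Poly_Mapping.lookup f k * \<phi> k)"
    by (intro laurent_sum_superset) auto
  also have "\<dots> = Poly_Mapping.lookup f 0 * \<phi> 0 +
      ((\<Sum>k\<in>int ` {1..r}. Poly_Mapping.lookup f k * \<phi> k) +
       (\<Sum>k\<in>(\<lambda>k. - int k) ` {1..r}. Poly_Mapping.lookup f k * \<phi> k))"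
    by (subst sum.insert, simp, force, subst sum.union_disjoint) auto
  also have "\<dots> = Poly_Mapping.lookup f 0 * \<phi> 0 +
     (\<Sum>k = 1..r. Poly_Mapping.lookup f (int k) * (\<phi> (int k) + \<phi> (- int k)))"
    by (simp add: sum.reindex inj_on_def sym distrib_left sum.distrib)
  finally show ?thesis .
qed

lemma Q_eq: "Q = [:Poly_Mapping.lookup f 0:] +
    (\<Sum>k = 1..r. Polynomial.smult (2 * Poly_Mapping.lookup f (int k)) (chebyshev_T k))"
  by (simp add: Q_def chebyshev_transform_def r_def)

lemma Q_joukowski:
  assumes "z \<noteq> 0"
  shows "poly Q ((z + inverse z) / 2) = laurent_sum (\<lambda>k. z powi k) f"
proof -
  have "poly Q ((z + inverse z) / 2) = Poly_Mapping.lookup f 0 +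
      (\<Sum>k = 1..r. Poly_Mapping.lookup f (int k) * (2 * poly (chebyshev_T k) ((z + inverse z) / 2)))"
    by (simp add: Q_eq poly_sum mult_ac)
  also have "\<dots> = laurent_sum (\<lambda>k. z powi k) f"
    unfolding laurent_sum_symmetric chebyshev_T_joukowski[OF assms]
    by (simp add: power_int_minus power_inverse)
  finally show ?thesis .
qed

lemma Q_root: "poly Q 1 = 0"
  using Q_joukowski[of 1] moment_0 by simp

text \<open>
  The Chebyshev polynomial \<open>T(k, w)\<close> has derivative \<open>k\<^sup>2\<close> at 1.
\<close>

lemma Q_deriv: "poly (pderiv Q) 1 = laurent_sum (\<lambda>k. of_int k ^ 2) f"
  unfolding laurent_sum_symmetric
  by (simp add: Q_eq pderiv_add pderiv_pCons higher_pderiv_sum[where n = "Suc 0", simplified] pderiv_smult poly_sum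
      chebyshev_T_deriv_at_1 mult_ac)

lemma Q_degree: "degree Q = r" and Q_lead: "lead_coeff Q = 2 ^ r * Poly_Mapping.lookup f (int r)"
proof -
  obtain m where m: "r = Suc m" using top_exponent(2) by (cases r) auto
  have "degree Q \<le> r"
    unfolding Q_eq
    by (intro degree_add_le degree_sum_le order.trans[OF degree_smult_le]
        order.trans[OF chebyshev_T_degree]) auto
  moreover have "Polynomial.coeff Q r = 2 ^ r * Poly_Mapping.lookup f (int r)"
  proof -
    have "Polynomial.coeff Q r = (\<Sum>k = 1..r. 2 * Poly_Mapping.lookup f (int k) * Polynomial.coeff (chebyshev_T k) r)"
      using top_exponent(2) by (simp add: Q_eq coeff_sum m)
    also have "\<dots> = (\<Sum>k\<in>{r}. 2 * Poly_Mapping.lookup f (int k) * Polynomial.coeff (chebyshev_T k) r)"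
    proof (rule sum.mono_neutral_right)
      show "\<forall>k\<in>{1..r} - {r}. 2 * Poly_Mapping.lookup f (int k) * Polynomial.coeff (chebyshev_T k) r = 0"
      proof
        fix k assume "k \<in> {1..r} - {r}"
        then have "degree (chebyshev_T k) < r" using chebyshev_T_degree[of k] by auto
        then show "2 * Poly_Mapping.lookup f (int k) * Polynomial.coeff (chebyshev_T k) r = 0"
          by (simp add: coeff_eq_0)
      qed
    qed (use top_exponent(2) in auto)
    finally show ?thesis by (simp add: m chebyshev_T_coeff)
  qed
  ultimately show "degree Q = r" "lead_coeff Q = 2 ^ r * Poly_Mapping.lookup f (int r)"
    using top_exponent(3) le_degree[of Q r] by simp_all
qed

definition "W = filter_mset (\<lambda>w. w \<noteq> 1) (proots Q)"

text \<open>
  The root 1 is simple because \<open>Q'(1)\<close>, the second moment, is nonzero.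
\<close>

lemma proots_Q: "proots Q = add_mset 1 W"
proof -
  have nz: "Q \<noteq> 0" using Q_degree top_exponent(2) by auto
  have "pderiv Q \<noteq> 0" using Q_deriv moment_2 by auto
  then have "order 1 Q = Suc (order 1 (pderiv Q))"
    using nz Q_root by (intro order_pderiv) (auto simp: order_root)
  moreover have "order 1 (pderiv Q) = 0"
    using Q_deriv moment_2 by (intro order_0I) simp
  ultimately have "count (proots Q) 1 = 1" using nz by simp
  then show ?thesis by (intro multiset_eqI) (simp add: W_def)
qed

lemma Q_factorization:
  "Q = Polynomial.smult (lead_coeff Q) ([:- 1, 1:] * (\<Prod>w\<in>#W. [:- w, 1:]))"
  using complex_poly_decompose_multiset[of Q] by (simp add: proots_Q)

lemma size_W: "size W + 1 = degree Q"
  using size_proots_complex[of Q] by (simp add: proots_Q)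

end

section \<open>Products over the roots of unity\<close>

text \<open>
  Both sides are monic of degree \<open>n\<close>, so their difference has smaller degree and cannot vanish at \<open>n\<close>
  distinct points unless it is zero.
\<close>

lemma prod_unity_roots_poly:
  assumes n: "0 < n"
  shows "(\<Prod>j<n. [:- (unity_root n ^ j), 1:]) = Polynomial.monom 1 n - 1"
proof (rule ccontr)
  let ?p = "\<Prod>j<n. [:- (unity_root n ^ j), 1:]" and ?q = "Polynomial.monom 1 n - 1 :: complex poly"
  assume "?p \<noteq> ?q"
  then have nz: "?p - ?q \<noteq> 0" by simp
  have p: "degree ?p = n" "Polynomial.coeff ?p n = 1"
  proof -
    show "degree ?p = n" by (simp add: degree_prod_eq_sum_degree)
    moreover have "lead_coeff ?p = 1" by (simp add: lead_coeff_prod)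
    ultimately show "Polynomial.coeff ?p n = 1" by simp
  qed
  have q: "degree ?q \<le> n" "Polynomial.coeff ?q n = 1"
    using n by (auto intro!: degree_diff_le degree_monom_le)
  have "degree (?p - ?q) \<le> n" by (rule degree_diff_le[OF _ q(1)]) (simp add: p(1))
  moreover have "Polynomial.coeff (?p - ?q) n = 0" using p(2) q(2) by simp
  moreover have "degree (?p - ?q) \<noteq> n" using nz calculation(2) by (metis leading_coeff_0_iff)
  ultimately have deg: "degree (?p - ?q) < n" by simp
  have "(\<lambda>j. unity_root n ^ j) ` {..<n} \<subseteq> {z. poly (?p - ?q) z = 0}"
  proof (clarify, goal_cases)
    case (1 _ j)
    then show ?case
      using n by (auto simp: poly_prod poly_monom unity_root_pow_n)
  qed
  then have "card ((\<lambda>j. unity_root n ^ j) ` {..<n}) \<le> card {z. poly (?p - ?q) z = 0}"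
    using poly_roots_finite[OF nz] by (rule card_mono[rotated])
  moreover have "card ((\<lambda>j. unity_root n ^ j) ` {..<n}) = n"
    by (subst card_image) (auto intro: inj_onI unity_root_inj)
  ultimately have "n \<le> degree (?p - ?q)"
    using card_poly_roots_bound[OF nz] by simp
  then show False using deg by simp
qed

lemma prod_unity_roots: "0 < n \<Longrightarrow> (\<Prod>j<n. z - unity_root n ^ j) = z ^ n - 1"
  using arg_cong[OF prod_unity_roots_poly, of n "\<lambda>p. poly p z"]
  by (simp add: poly_prod poly_monom)

lemma norm_unity_root_pow [simp]: "cmod (unity_root n ^ j) = 1"
  by (simp add: unity_root_def norm_power)

text \<open>
  This is \<open>2 cos (2 \<pi> j / n)\<close>.
\<close>

definition unity_cos2 :: "nat \<Rightarrow> nat \<Rightarrow> complex" where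
  "unity_cos2 n j = unity_root n ^ j + inverse (unity_root n ^ j)"

lemma unity_cos2_0 [simp]: "unity_cos2 n 0 = 2"
  by (simp add: unity_cos2_def)

lemma cmod_joukowski_diff:
  assumes z: "z \<noteq> 0"
  shows "cmod (unity_cos2 n j - (z + inverse z)) =
    cmod ((z - unity_root n ^ j) * (inverse z - unity_root n ^ j))"
proof -
  let ?u = "unity_root n ^ j"
  \<comment> \<open>The factor \<open>?u\<close> of absolute value 1 makes the factorization polynomial in \<open>?u\<close>.\<close>
  have "?u * (unity_cos2 n j - (z + inverse z)) = (z - ?u) * (inverse z - ?u)"
    using z by (simp add: unity_cos2_def field_simps)
  then show ?thesis
    by (metis mult_1 norm_mult norm_unity_root_pow)
qed

text \<open>
  With \<open>2 w = z + 1/z\<close> the left-hand side is the absolute value of \<open>(z\<^sup>n - 1) (z\<^sup>-\<^sup>n - 1)\<close>, because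
  \<open>u (u + 1/u - z - 1/z) = (z - u) (1/z - u)\<close> and \<open>\<bar>u\<bar> = 1\<close> for a root of unity \<open>u\<close>.
\<close>

lemma prod_chebyshev_T:
  assumes n: "0 < n"
  shows "(\<Prod>j<n. cmod (unity_cos2 n j - 2 * w)) = cmod (2 * poly (chebyshev_T n) w - 2)"
proof -
  define z where "z = exp (\<i> * Arccos w)"
  have z: "z \<noteq> 0" "inverse z = exp (- (\<i> * Arccos w))" by (simp_all add: z_def exp_minus)
  have "2 * w = exp (\<i> * Arccos w) + exp (- (\<i> * Arccos w))"
    using cos_Arccos[of w] by (simp add: cos_exp_eq)
  then have w: "2 * w = z + inverse z"
    unfolding z(2) unfolding z_def .
  have "(\<Prod>j<n. cmod (unity_cos2 n j - 2 * w)) =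
      cmod ((\<Prod>j<n. z - unity_root n ^ j) * (\<Prod>j<n. inverse z - unity_root n ^ j))"
    unfolding w cmod_joukowski_diff[OF z(1)] prod_norm by (simp add: prod.distrib)
  also have "\<dots> = cmod ((z ^ n - 1) * (inverse z ^ n - 1))"
    using n by (simp add: prod_unity_roots)
  also have "(z ^ n - 1) * (inverse z ^ n - 1) = 2 - (z ^ n + inverse z ^ n)"
    using z(1) by (simp add: field_simps)
  also have "z ^ n + inverse z ^ n = 2 * poly (chebyshev_T n) w"
    using chebyshev_T_joukowski[OF z(1), of n] w by (metis mult_2 field_sum_of_halves nonzero_mult_div_cancel_left zero_neq_numeral)
  finally show ?thesis by (simp add: norm_minus_commute)
qed

text \<open>
  Differentiating \<open>z\<^sup>n - 1 = (z - 1) \<Prod>(z - \<zeta>)\<close> at \<open>z = 1\<close> gives \<open>\<Prod>(1 - \<zeta>) = n\<close> for the product over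
  the nontrivial roots of unity, and \<open>\<bar>\<zeta> + 1/\<zeta> - 2\<bar> = \<bar>1 - \<zeta>\<bar>\<^sup>2\<close>.
\<close>

lemma prod_unity_cos2_minus_2:
  assumes n: "0 < n"
  shows "(\<Prod>j\<in>{1..<n}. cmod (unity_cos2 n j - 2)) = real n ^ 2"
proof -
  let ?R = "\<Prod>j\<in>{1..<n}. [:- (unity_root n ^ j), 1:]"
  have "{..<n} = insert 0 {1..<n}" using n by auto
  then have "[:- 1, 1:] * ?R = Polynomial.monom 1 n - 1"
    using prod_unity_roots_poly[OF n] by simp
  then have "poly (pderiv ([:- 1, 1:] * ?R)) 1 = poly (pderiv (Polynomial.monom 1 n - 1)) 1"
    by simp
  then have "poly ?R 1 = of_nat n"
    by (simp add: pderiv_mult pderiv_pCons pderiv_diff pderiv_monom poly_monom)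
  then have R: "(\<Prod>j\<in>{1..<n}. 1 - unity_root n ^ j) = of_nat n"
    by (simp add: poly_prod)
  have "(\<Prod>j\<in>{1..<n}. cmod (unity_cos2 n j - 2)) = cmod (\<Prod>j\<in>{1..<n}. 1 - unity_root n ^ j) ^ 2"
    using cmod_joukowski_diff[of 1 n]
    by (simp add: prod_norm[symmetric] norm_mult power2_eq_square prod.distrib)
  then show ?thesis unfolding R by simp
qed

lemma prod_prod_mset_swap:
  fixes g :: "'a \<Rightarrow> 'b \<Rightarrow> 'c :: comm_monoid_mult"
  shows "(\<Prod>j\<in>J. \<Prod>w\<in>#M. g j w) = (\<Prod>w\<in>#M. \<Prod>j\<in>J. g j w)"
  by (induction M) (simp_all add: prod.distrib)

lemma poly_linear_mult: "poly ([:- a, 1:] * p) x = (x - a) * poly p (x :: 'a :: comm_ring_1)"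
  by (simp add: algebra_simps)

lemma cmod_prod_linear_factors:
  "cmod (poly (\<Prod>w\<in>#M. [:- w, 1:]) (x / 2)) * 2 ^ size M = (\<Prod>w\<in>#M. cmod (x - 2 * w))"
proof (induction M)
  case (add w M)
  have "cmod (x / 2 - w) * 2 = cmod (x - 2 * w)"
  proof -
    have "x - 2 * w = (x / 2 - w) * 2" by simp
    then show ?thesis by (simp only: norm_mult norm_numeral)
  qed
  then show ?case using add by (simp add: poly_linear_mult norm_mult mult_ac del: mult_pCons_left)
qed simp

context symmetric_laurent
begin

text \<open>
  The leading coefficient of \<open>Q\<close> is \<open>2\<^sup>r \<eta>\<close>.  Its \<open>r\<close> factors 2 are spread over the \<open>r\<close> linear factors, so
  that only the leading coefficient \<open>\<eta>\<close> of the Laurent polynomial is left.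
\<close>

lemma cmod_Q:
  "cmod (poly Q (x / 2)) = cmod (Poly_Mapping.lookup f (int r)) * cmod (x - 2) *
     (\<Prod>w\<in>#W. cmod (x - 2 * w))"
proof -
  have r: "2 ^ r = (2 * 2 ^ size W :: real)" using size_W Q_degree by (simp flip: power_Suc)
  have x: "cmod (x / 2 - 1) * 2 = cmod (x - 2)"
  proof -
    have "x - 2 = (x / 2 - 1) * 2" by simp
    then show ?thesis by (simp only: norm_mult norm_numeral)
  qed
  have "poly Q (x / 2) = lead_coeff Q * ((x / 2 - 1) * poly (\<Prod>w\<in>#W. [:- w, 1:]) (x / 2))"
    by (subst Q_factorization) (simp add: poly_linear_mult del: mult_pCons_left)
  then have "cmod (poly Q (x / 2)) = 2 ^ r * cmod (Poly_Mapping.lookup f (int r)) *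
      (cmod (x / 2 - 1) * cmod (poly (\<Prod>w\<in>#W. [:- w, 1:]) (x / 2)))"
    by (simp add: Q_lead norm_mult norm_power)
  also have "\<dots> = cmod (Poly_Mapping.lookup f (int r)) * (cmod (x / 2 - 1) * 2) *
      (cmod (poly (\<Prod>w\<in>#W. [:- w, 1:]) (x / 2)) * 2 ^ size W)"
    by (simp add: r mult_ac)
  finally show ?thesis unfolding x cmod_prod_linear_factors .
qed

text \<open>
  The second moment is \<open>Q'(1)\<close>.  Splitting off the linear factor at the simple root 1 leaves the
  product of the remaining factors at 1, which uses up all but one of the \<open>r\<close> factors 2 of the
  leading coefficient.
\<close>

lemma cmod_moment_2:
  "cmod (laurent_sum (\<lambda>k. of_int k ^ 2) f) =
     2 * cmod (Poly_Mapping.lookup f (int r)) * (\<Prod>w\<in>#W. cmod (2 - 2 * w))"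
proof -
  let ?R = "\<Prod>w\<in>#W. [:- w, 1:]"
  have r: "2 ^ r = (2 * 2 ^ size W :: real)" using size_W Q_degree by (simp flip: power_Suc)
  have "laurent_sum (\<lambda>k. of_int k ^ 2) f = lead_coeff Q * poly ?R 1"
    unfolding Q_deriv[symmetric]
    by (subst Q_factorization) (simp add: pderiv_smult pderiv_mult pderiv_pCons del: mult_pCons_left)
  then have "cmod (laurent_sum (\<lambda>k. of_int k ^ 2) f) =
      2 * cmod (Poly_Mapping.lookup f (int r)) * (cmod (poly ?R (2 / 2)) * 2 ^ size W)"
    by (simp add: Q_lead norm_mult norm_power r)
  then show ?thesis unfolding cmod_prod_linear_factors .
qed

text \<open>
  The identity is stated in product form to avoid a division: multiplication by the second moment
  supplies, for each root \<open>w\<close>, the factor \<open>\<bar>2 - 2 w\<bar>\<close> of the trivial root of unity, and a factor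
  \<open>2 \<bar>\<eta>\<bar>\<close> which completes the power of \<open>\<bar>\<eta>\<bar>\<close>.
\<close>

theorem prod_over_unity_roots:
  assumes n: "0 < n"
  shows "(\<Prod>j\<in>{1..<n}. cmod (laurent_sum (\<lambda>k. (unity_root n ^ j) powi k) f)) *
      cmod (laurent_sum (\<lambda>k. of_int k ^ 2) f) =
    2 * real n ^ 2 * cmod (Poly_Mapping.lookup f (int r)) ^ n *
      (\<Prod>w\<in>#W. cmod (2 * poly (chebyshev_T n) w - 2))"
proof -
  let ?\<eta> = "cmod (Poly_Mapping.lookup f (int r))"
  have "(\<Prod>j\<in>{1..<n}. cmod (laurent_sum (\<lambda>k. (unity_root n ^ j) powi k) f)) =
      (\<Prod>j\<in>{1..<n}. cmod (poly Q (unity_cos2 n j / 2)))"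
    by (simp add: unity_cos2_def Q_joukowski)
  also have "\<dots> = ?\<eta> ^ (n - 1) * real n ^ 2 * (\<Prod>w\<in>#W. \<Prod>j\<in>{1..<n}. cmod (unity_cos2 n j - 2 * w))"
    unfolding cmod_Q prod.distrib prod_unity_cos2_minus_2[OF n] prod_prod_mset_swap by simp
  finally have "(\<Prod>j\<in>{1..<n}. cmod (laurent_sum (\<lambda>k. (unity_root n ^ j) powi k) f)) *
      cmod (laurent_sum (\<lambda>k. of_int k ^ 2) f) =
      2 * real n ^ 2 * (?\<eta> ^ (n - 1) * ?\<eta>) *
      ((\<Prod>w\<in>#W. cmod (2 - 2 * w)) * (\<Prod>w\<in>#W. \<Prod>j\<in>{1..<n}. cmod (unity_cos2 n j - 2 * w)))"
    by (simp add: cmod_moment_2 mult_ac)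
  also have "?\<eta> ^ (n - 1) * ?\<eta> = ?\<eta> ^ n"
    using n by (rule power_minus_mult)
  also have "(\<Prod>w\<in>#W. cmod (2 - 2 * w)) * (\<Prod>w\<in>#W. \<Prod>j\<in>{1..<n}. cmod (unity_cos2 n j - 2 * w)) =
      (\<Prod>w\<in>#W. cmod (2 * poly (chebyshev_T n) w - 2))"
  proof -
    have "{..<n} = insert 0 {1..<n}" using n by auto
    then show ?thesis
      by (simp add: prod_mset.distrib[symmetric] prod_chebyshev_T[OF n, symmetric])
  qed
  finally show ?thesis .
qed

end

section \<open>The number of spanning trees\<close>

lemma laurent_sum_A:
  "laurent_sum \<phi> (laurent_A s t \<beta>) =
     of_nat (2 * s + t) * \<phi> 0 - (\<Sum>i = 1..s. \<phi> (\<beta> i) + \<phi> (- \<beta> i))"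
  by (simp only: laurent_A_def laurent_sum_diff laurent_sum_of_nat laurent_sum_sum
      laurent_sum_add laurent_sum_single mult_1)

lemma laurent_sum_B: "laurent_sum \<phi> (laurent_B t \<gamma>) = - (\<Sum>i = 1..t. \<phi> (\<gamma> i))"
  by (simp only: laurent_B_def laurent_sum_uminus laurent_sum_sum laurent_sum_single mult_1)

text \<open>
  Lagrange's identity for the sequence \<open>c\<close> and the constant sequence 1.
\<close>

lemma sum_pairwise_square_diffs:
  fixes c :: "nat \<Rightarrow> int"
  shows "(\<Sum>k = 1..t. \<Sum>j = 1..<k. (c j - c k)\<^sup>2) =
    int t * (\<Sum>k = 1..t. (c k)\<^sup>2) - (\<Sum>k = 1..t. c k)\<^sup>2"
proof (induction t)
  case (Suc t)
  have "(\<Sum>j = 1..<Suc t. (c j - c (Suc t))\<^sup>2) =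
      (\<Sum>j = 1..t. (c j)\<^sup>2 + (c (Suc t))\<^sup>2 - 2 * c (Suc t) * c j)"
    by (intro sum.cong) (auto simp: power2_eq_square algebra_simps)
  also have "\<dots> = (\<Sum>j = 1..t. (c j)\<^sup>2) + int t * (c (Suc t))\<^sup>2 - 2 * c (Suc t) * (\<Sum>j = 1..t. c j)"
    by (simp add: sum.distrib sum_subtractf sum_distrib_left)
  finally show ?case using Suc by (simp add: power2_eq_square algebra_simps)
qed simp

text \<open>
  The polynomial \<open>\<A>\<close> has unit sum \<open>t\<close>, first moment 0 and second moment \<open>-2 \<Sum>\<beta>\<^sup>2\<close>; for \<open>\<B>\<close> these are
  \<open>-t\<close>, \<open>-\<Sum>\<gamma>\<close> and \<open>-\<Sum>\<gamma>\<^sup>2\<close>.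
\<close>

lemma associated_laurent_second_moment:
  "laurent_sum (\<lambda>k. of_int k ^ 2) (associated_laurent s t \<beta> \<gamma>) =
    - 2 * of_int (2 * int t * (\<Sum>j = 1..s. (\<beta> j)\<^sup>2) + (\<Sum>k = 1..t. \<Sum>j = 1..<k. (\<gamma> j - \<gamma> k)\<^sup>2))"
  unfolding associated_laurent_def laurent_sum_diff laurent_second_moment_mult_inv
    laurent_sum_A laurent_sum_B sum_pairwise_square_diffs
  by (simp add: sum.distrib sum_negf algebra_simps sum_distrib_left[symmetric])

text \<open>
  This is \<open>P(1) = \<A>(1)\<^sup>2 - \<B>(1)\<^sup>2 = t\<^sup>2 - t\<^sup>2\<close>.
\<close>

lemma associated_laurent_unit_sum:
  "laurent_sum (\<lambda>_. 1) (associated_laurent s t \<beta> \<gamma>) = 0"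
  using laurent_sum_power_mult[of 1 "laurent_A s t \<beta>" "laurent_inv (laurent_A s t \<beta>)"]
    laurent_sum_power_mult[of 1 "laurent_B t \<gamma>" "laurent_inv (laurent_B t \<gamma>)"]
  by (simp add: associated_laurent_def laurent_sum_diff laurent_sum_inv laurent_sum_A laurent_sum_B)

lemma associated_laurent_eval:
  assumes "z \<noteq> 0"
  shows "laurent_sum (\<lambda>k. z powi k) (associated_laurent s t \<beta> \<gamma>) =
    (of_nat (2 * s + t) - (\<Sum>i = 1..s. z powi (\<beta> i) + z powi (- \<beta> i)))\<^sup>2 -
    (\<Sum>i = 1..t. z powi (- \<gamma> i)) * (\<Sum>i = 1..t. z powi (\<gamma> i))"
  unfolding associated_laurent_def laurent_sum_diff laurent_sum_power_mult[OF assms]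
    laurent_sum_inv laurent_sum_A laurent_sum_B
  by (simp add: power2_eq_square add.commute mult.commute)

lemma int_dvd_small_eq_0:
  assumes "int n dvd d" "\<bar>d\<bar> < int n"
  shows "d = 0"
  using assms dvd_imp_le_int[of d "int n"] by auto

theorem theorem3p2:
  fixes n s t :: nat and \<beta> \<gamma> :: "nat \<Rightarrow> int"
  assumes "n \<ge> 1" and "t \<ge> 1"
    and "\<forall>i\<in>{1..s}. 0 < \<beta> i \<and> real_of_int (\<beta> i) < real n / 2"
    and "strict_mono_on {1..s} \<beta>"
    and "\<forall>i\<in>{1..t}. 0 \<le> \<gamma> i \<and> \<gamma> i \<le> int n - 1"
    and "strict_mono_on {1..t} \<gamma>"
    and "\<not> (s = 0 \<and> t = 1)"  \<comment> \<open>exactly in the excluded case \<open>P = 0\<close> and \<open>q = 0\<close>\<close>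
  shows "let P = associated_laurent s t \<beta> \<gamma>;
             Q = chebyshev_transform P;
             r = degree Q;
             \<eta> = laurent_leading P;
             q = 2 * int t * (\<Sum>j = 1..s. (\<beta> j)\<^sup>2) + (\<Sum>k = 1..t. \<Sum>j = 1..<k. (\<gamma> j - \<gamma> k)\<^sup>2);
             W = filter_mset (\<lambda>w. w \<noteq> 1) (proots Q)
         in size W + 1 = r \<and>
            real (num_spanning_trees n s t \<beta> \<gamma>) =
              real n * real t * cmod \<eta> ^ n / real_of_int q *
              (\<Prod>w\<in>#W. cmod (2 * poly (chebyshev_T n) w - 2))"
proof -
  have n: "0 < n" using assms(1) by simp
  have \<beta>: "0 < \<beta> i" "2 * \<beta> i < int n" if "i \<in> {1..s}" for i
  proof -
    have "0 < \<beta> i \<and> real_of_int (2 * \<beta> i) < real_of_int (int n)"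
      using bspec[OF assms(3) that] by simp
    then show "0 < \<beta> i" "2 * \<beta> i < int n" by (simp_all only: of_int_less_iff)
  qed
  have \<gamma>: "0 \<le> \<gamma> i" "\<gamma> i < int n" if "i \<in> {1..t}" for i
    using assms(5) that by auto
  have \<beta>_inj: "inj_on \<beta> {1..s}" using assms(4) by (rule strict_mono_on_imp_inj_on)
  have \<gamma>_inj: "inj_on \<gamma> {1..t}" using assms(6) by (rule strict_mono_on_imp_inj_on)

  \<comment> \<open>The bounds on \<open>\<beta>\<close> and \<open>\<gamma>\<close> make the exponents incongruent modulo \<open>n\<close>: those in \<open>X\<close> have
    absolute value below \<open>n / 2\<close>, those in \<open>Y\<close> lie in one full period.\<close>
  define X where "X = \<beta> ` {1..s} \<union> (\<lambda>i. - \<beta> i) ` {1..s}"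
  define Y where "Y = \<gamma> ` {1..t}"
  have X_bound: "x \<noteq> 0 \<and> 2 * \<bar>x\<bar> < int n" if "x \<in> X" for x
  proof -
    obtain i where "i \<in> {1..s}" "x = \<beta> i \<or> x = - \<beta> i" using \<open>x \<in> X\<close> unfolding X_def by blast
    then show ?thesis using \<beta>[of i] by auto
  qed
  have sum_X: "(\<Sum>x\<in>X. \<phi> x) = (\<Sum>i = 1..s. \<phi> (\<beta> i) + \<phi> (- \<beta> i))" for \<phi> :: "int \<Rightarrow> complex"
  proof -
    have "\<beta> i \<noteq> - \<beta> j" if "i \<in> {1..s}" "j \<in> {1..s}" for i j
      using \<beta>(1)[OF that(1)] \<beta>(1)[OF that(2)] by simp
    then have "\<beta> ` {1..s} \<inter> (\<lambda>i. - \<beta> i) ` {1..s} = {}"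
      by blast
    then have "(\<Sum>x\<in>X. \<phi> x) = (\<Sum>x\<in>\<beta> ` {1..s}. \<phi> x) + (\<Sum>x\<in>(\<lambda>i. - \<beta> i) ` {1..s}. \<phi> x)"
      unfolding X_def by (intro sum.union_disjoint) auto
    moreover have neg_inj: "inj_on (\<lambda>i. - \<beta> i) {1..s}"
      by (rule inj_onI) (metis \<beta>_inj inj_onD minus_minus)
    ultimately have "(\<Sum>x\<in>X. \<phi> x) = (\<Sum>i = 1..s. \<phi> (\<beta> i)) + (\<Sum>i = 1..s. \<phi> (- \<beta> i))"
      by (simp only: sum.reindex[OF \<beta>_inj] sum.reindex[OF neg_inj] o_def)
    then show ?thesis by (simp add: sum.distrib)
  qed
  have sum_Y: "(\<Sum>y\<in>Y. \<phi> y) = (\<Sum>i = 1..t. \<phi> (\<gamma> i))" for \<phi> :: "int \<Rightarrow> complex"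
    by (simp only: Y_def sum.reindex[OF \<gamma>_inj] o_def)
  have card_X: "card X = 2 * s"
  proof -
    have "of_nat (card X) = (of_nat (2 * s) :: complex)" using sum_X[of "\<lambda>_. 1"] by simp
    then show ?thesis by (simp only: of_nat_eq_iff)
  qed
  have card_Y: "card Y = t" unfolding Y_def card_image[OF \<gamma>_inj] by simp

  define \<tau> where "\<tau> = num_spanning_trees n s t \<beta> \<gamma>"
  define P where "P = associated_laurent s t \<beta> \<gamma>"
  define q where
    "q = 2 * int t * (\<Sum>j = 1..s. (\<beta> j)\<^sup>2) + (\<Sum>k = 1..t. \<Sum>j = 1..<k. (\<gamma> j - \<gamma> k)\<^sup>2)"
  \<comment> \<open>If \<open>s = 0\<close>, then \<open>t \<ge> 2\<close> and the pair \<open>\<gamma>\<^sub>1 < \<gamma>\<^sub>2\<close> contributes.\<close>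
  have q_pos: "0 < q"
  proof (cases "s = 0")
    case False
    have "0 < (\<Sum>j = 1..s. (\<beta> j)\<^sup>2)"
    proof (rule sum_pos)
      show "{1..s} \<noteq> {}" using False by simp
      show "0 < (\<beta> j)\<^sup>2" if "j \<in> {1..s}" for j using \<beta>(1)[OF that] by simp
    qed simp
    moreover have "0 \<le> (\<Sum>k = 1..t. \<Sum>j = 1..<k. (\<gamma> j - \<gamma> k)\<^sup>2)"
      by (intro sum_nonneg) simp
    ultimately show ?thesis
      unfolding q_def using assms(2) by (intro add_pos_nonneg mult_pos_pos) auto
  next
    case True
    then have t: "2 \<le> t" using assms(2,7) by simp
    have "\<gamma> 1 < \<gamma> 2" using assms(6) t by (intro strict_mono_onD[of "{1..t}" \<gamma>]) auto
    then have "0 < (\<gamma> 1 - \<gamma> 2)\<^sup>2" by simp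
    also have "\<dots> = (\<Sum>j = 1..<2. (\<gamma> j - \<gamma> 2)\<^sup>2)" by (simp add: numeral_2_eq_2)
    also have "\<dots> \<le> (\<Sum>k = 1..t. \<Sum>j = 1..<k. (\<gamma> j - \<gamma> k)\<^sup>2)"
    proof (rule member_le_sum[where f = "\<lambda>k. \<Sum>j = 1..<k. (\<gamma> j - \<gamma> k)\<^sup>2"])
      show "2 \<in> {1..t}" using t by simp
      show "0 \<le> (\<Sum>j = 1..<k. (\<gamma> j - \<gamma> k)\<^sup>2)" for k by (intro sum_nonneg) simp
    qed simp
    finally show ?thesis by (simp add: q_def True)
  qed
  have moment: "laurent_sum (\<lambda>k. of_int k ^ 2) P = - 2 * of_int q"
    unfolding P_def q_def by (rule associated_laurent_second_moment)

  interpret P: symmetric_laurent P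
  proof
    show "Poly_Mapping.lookup P (- k) = Poly_Mapping.lookup P k" for k
      by (simp add: P_def associated_laurent_def lookup_minus lookup_mult_inv_sym)
    show "laurent_sum (\<lambda>_. 1) P = 0" unfolding P_def by (rule associated_laurent_unit_sum)
    show "laurent_sum (\<lambda>k. of_int k ^ 2) P \<noteq> 0" using q_pos by (simp add: moment)
  qed

  have "of_nat (n * \<tau>) = of_nat (card Y) * (\<Prod>j\<in>{1..<n}.
      (of_nat (card X + card Y) - (\<Sum>m\<in>X. (unity_root n ^ j) powi m))\<^sup>2 -
       (\<Sum>m\<in>Y. (unity_root n ^ j) powi (- m)) * (\<Sum>m\<in>Y. (unity_root n ^ j) powi m))"
    unfolding \<tau>_def num_spanning_trees_def
  proof (rule dihedral_spanning_trees_product[OF n])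
    show "uminus ` X = X"
      by (auto simp: X_def image_Un image_image)
    show "x = y" if "x \<in> X" "y \<in> X" "int n dvd x - y" for x y
      using int_dvd_small_eq_0[OF that(3)] X_bound[OF that(1)] X_bound[OF that(2)] by linarith
    show "\<not> int n dvd x" if "x \<in> X" for x
      using int_dvd_small_eq_0[of n x] X_bound[OF that] by auto
    show "x = y" if "x \<in> Y" "y \<in> Y" "int n dvd x - y" for x y
    proof -
      have "0 \<le> x" "x < int n" "0 \<le> y" "y < int n" using that \<gamma> by (auto simp: Y_def)
      then have "x - y = 0" using that(3) by (intro int_dvd_small_eq_0) auto
      then show ?thesis by simp
    qed
    show "dihedral_connection_set n s t \<beta> \<gamma> =
        {dih_elt n x False | x. x \<in> X} \<union> {dih_elt n (- y) True | y. y \<in> Y}"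
      unfolding X_def Y_def by (rule connection_set_eq)
  qed (simp_all add: X_def Y_def)
  also have "\<dots> = of_nat t * (\<Prod>j\<in>{1..<n}. laurent_sum (\<lambda>k. (unity_root n ^ j) powi k) P)"
    unfolding P_def by (simp add: associated_laurent_eval sum_X sum_Y card_X card_Y)
  \<comment> \<open>The formula involves absolute values of the factors; as \<open>n \<tau>\<close> is a natural number, nothing is
    lost by passing to absolute values.\<close>
  finally have "cmod (of_nat (n * \<tau>)) =
      cmod (of_nat t * (\<Prod>j\<in>{1..<n}. laurent_sum (\<lambda>k. (unity_root n ^ j) powi k) P))"
    by (rule arg_cong)
  then have count: "real n * real \<tau> =
      real t * (\<Prod>j\<in>{1..<n}. cmod (laurent_sum (\<lambda>k. (unity_root n ^ j) powi k) P))"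
    by (simp only: norm_mult norm_of_nat of_nat_mult prod_norm)
  have "(\<Prod>j\<in>{1..<n}. cmod (laurent_sum (\<lambda>k. (unity_root n ^ j) powi k) P)) * (2 * real_of_int q) =
      2 * real n ^ 2 * cmod (laurent_leading P) ^ n *
      (\<Prod>w\<in>#P.W. cmod (2 * poly (chebyshev_T n) w - 2))"
    using P.prod_over_unity_roots[OF n] q_pos
    by (simp add: moment norm_mult laurent_leading_def P.top_exponent(1))
  then have prod: "(\<Prod>j\<in>{1..<n}. cmod (laurent_sum (\<lambda>k. (unity_root n ^ j) powi k) P)) =
      real n ^ 2 * cmod (laurent_leading P) ^ n / real_of_int q *
      (\<Prod>w\<in>#P.W. cmod (2 * poly (chebyshev_T n) w - 2))"
    using q_pos by (simp add: field_simps)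
  have "real n * real \<tau> = real n * (real n * real t * cmod (laurent_leading P) ^ n / real_of_int q *
      (\<Prod>w\<in>#P.W. cmod (2 * poly (chebyshev_T n) w - 2)))"
    unfolding count prod by (simp add: power2_eq_square)
  then have "real \<tau> = real n * real t * cmod (laurent_leading P) ^ n / real_of_int q *
      (\<Prod>w\<in>#P.W. cmod (2 * poly (chebyshev_T n) w - 2))"
    by (rule mult_left_cancel[THEN iffD1, rotated]) (use n in simp)
  from conjI[OF P.size_W this, unfolded P.W_def P.Q_def] show ?thesis
    unfolding Let_def P_def \<tau>_def q_def .
qed

end
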